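(* For any positive integers $d,t\ge 1$ there exists a constant $c=c(d,t)>0$ with the following property. Let $0<\varepsilon<1/2$ and let $V$ be an $n$-element point set in $\mathbb{R}^d$ equipped with semi-algebraic relations $E_1,\dots,E_m$ such that each $E_k$ has complexity at most $t$ and $\binom{V}{2}=E_1\cup\dots\cup E_m$. Then $V$ has an equitable partition $V=V_1\cup\dots\cup V_K$ into $K$ parts, where $4/\varepsilon\le K\le (m/\varepsilon)^c$, such that all but an $\varepsilon$-fraction of the pairs of parts are complete with respect to some relation $E_k$.
   Context: Standing convention: the dimension $d$ and the complexity $t$ are fixed parameters, and $n=|V|$ tends to infinity. Semi-algebraic relations. Let $V$ be a finite set of points in $\mathbb{R}^d$ and let $E\subset\binom{V}{2}$. Then $E$ is a (symmetric) semi-algebraic relation on $V$ of complexity at most $t$ if there are polynomials $g_1,\dots,g_s\in\mathbb{R}[x_1,\dots,x_{2d}]$ with $s\le t$, each of degree at most $t$, and a Boolean formula $\Phi$ such that for all distinct $u,v\in V$, $$uv\in E\iff \Phi\big(g_1(u,v)\ge 0;\dots;g_s(u,v)\ge 0\big)=1,$$ where $uv=\{u,v\}$, and in $g_\ell(u,v)$ the variables $x_1,\dots,x_d$ are replaced by the coordinates of $u$ and $x_{d+1},\dots,x_{2d}$ by the coordinates of $v$. The relation defined by $\Phi$ and the $g_\ell$ is assumed to be symmetric: for all $u,v\in\mathbb{R}^d$, the right-hand side holds for $(u,v)$ if and only if it holds for $(v,u)$. A partition is equitable if any two parts differ in size by at most one. A pair of parts $(V_i,V_j)$ is complete with respect to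 $E_k$ if all edges between the two parts have color $k$, i.e. all edges $uv$ with $u\in V_i$, $v\in V_j$ belong to $E_k$. *)

theory Defs
  imports
    "HOL-Analysis.Analysis"
    "HOL-Library.Poly_Mapping"
    "HOL-Library.Ramsey"
    "HOL-Library.Disjoint_Sets"
begin

text \<open>
  A polynomial with real coefficients in variables indexed by \<open>'x\<close> is a finitely supported map
  from monomials (finitely supported exponent vectors \<open>'x \<Rightarrow>\<^sub>0 nat\<close>) to coefficients.
\<close>

type_synonym 'x real_mpoly = "('x \<Rightarrow>\<^sub>0 nat) \<Rightarrow>\<^sub>0 real"

definition monom_degree :: "('x \<Rightarrow>\<^sub>0 nat) \<Rightarrow> nat" where
  "monom_degree \<mu> = (\<Sum>x\<in>Poly_Mapping.keys \<mu>. Poly_Mapping.lookup \<mu> x)"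

definition total_degree :: "'x real_mpoly \<Rightarrow> nat" where
  "total_degree p = Max (insert 0 (monom_degree ` Poly_Mapping.keys p))"

definition eval_mpoly :: "'x real_mpoly \<Rightarrow> ('x \<Rightarrow> real) \<Rightarrow> real" where
  "eval_mpoly p a =
     (\<Sum>\<mu>\<in>Poly_Mapping.keys p. Poly_Mapping.lookup p \<mu> *
        (\<Prod>x\<in>Poly_Mapping.keys \<mu>. a x ^ Poly_Mapping.lookup \<mu> x))"

text \<open>
  The \<open>2d\<close> variables are indexed by \<open>'d + 'd\<close>: \<open>Inl i\<close> is the \<open>i\<close>-th coordinate of the
  first point, \<open>Inr i\<close> the \<open>i\<close>-th coordinate of the second.
\<close>

definition eval_pair :: "('d + 'd) real_mpoly \<Rightarrow> real ^ 'd \<Rightarrow> real ^ 'd \<Rightarrow> real" where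
  "eval_pair g u v = eval_mpoly g (case_sum (\<lambda>i. u $ i) (\<lambda>i. v $ i))"

datatype (atoms: 'a) bool_formula =
    Truth
  | Atom 'a
  | Neg "'a bool_formula"
  | Conj "'a bool_formula" "'a bool_formula"
  | Disj "'a bool_formula" "'a bool_formula"

primrec holds :: "('a \<Rightarrow> bool) \<Rightarrow> 'a bool_formula \<Rightarrow> bool" where
  "holds b Truth = True"
| "holds b (Atom a) = b a"
| "holds b (Neg \<phi>) = (\<not> holds b \<phi>)"
| "holds b (Conj \<phi> \<psi>) = (holds b \<phi> \<and> holds b \<psi>)"
| "holds b (Disj \<phi> \<psi>) = (holds b \<phi> \<or> holds b \<psi>)"

text \<open>
  The truth value of \<open>\<Phi>(g\<^sub>0(u,v) \<ge> 0; \<dots>; g\<^sub>s\<^sub>-\<^sub>1(u,v) \<ge> 0)\<close>; the atom \<open>l\<close> of the formula refers to the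
  polynomial \<open>gs ! l\<close>, so it is meaningful for \<open>atoms \<Phi> \<subseteq> {..<length gs}\<close>.
\<close>

definition semialg_holds ::
  "('d + 'd) real_mpoly list \<Rightarrow> nat bool_formula \<Rightarrow> real ^ 'd \<Rightarrow> real ^ 'd \<Rightarrow> bool" where
  "semialg_holds gs \<Phi> u v = holds (\<lambda>l. eval_pair (gs ! l) u v \<ge> 0) \<Phi>"

definition semialgebraic_relation :: "nat \<Rightarrow> (real ^ 'd) set \<Rightarrow> (real ^ 'd) set set \<Rightarrow> bool" where
  "semialgebraic_relation t V E \<longleftrightarrow>
     E \<subseteq> nsets V 2 \<and>
     (\<exists>gs \<Phi>. length gs \<le> t \<and> (\<forall>g\<in>set gs. total_degree g \<le> t) \<and>
        atoms \<Phi> \<subseteq> {..<length gs} \<and>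
        (\<forall>u v. semialg_holds gs \<Phi> u v \<longleftrightarrow> semialg_holds gs \<Phi> v u) \<and>
        (\<forall>u\<in>V. \<forall>v\<in>V. u \<noteq> v \<longrightarrow> ({u, v} \<in> E \<longleftrightarrow> semialg_holds gs \<Phi> u v)))"

text \<open>
  The parts are \<open>P 1, \<dots>, P K\<close>.  Emptiness of a part is not excluded here, since otherwise no
  point set with fewer than \<open>K\<close> elements would have such a partition; for \<open>K \<le> card V\<close> the
  size condition forces all parts to be nonempty.
\<close>

definition equitable_partition :: "'a set \<Rightarrow> nat \<Rightarrow> (nat \<Rightarrow> 'a set) \<Rightarrow> bool" where
  "equitable_partition V K P \<longleftrightarrow>
     disjoint_family_on P {1..K} \<and> V = (\<Union>i\<in>{1..K}. P i) \<and>
     (\<forall>i\<in>{1..K}. \<forall>j\<in>{1..K}. card (P i) \<le> card (P j) + 1)"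

definition complete_pair :: "'a set set \<Rightarrow> 'a set \<Rightarrow> 'a set \<Rightarrow> bool" where
  "complete_pair E A B \<longleftrightarrow> (\<forall>u\<in>A. \<forall>v\<in>B. {u, v} \<in> E)"

end

theory Submission
  imports Defs
begin

text \<open>
  Expanding a polynomial in monomials turns \<open>g(u, v)\<close> into a pairing between the Veronese images of
  \<open>u\<close> and \<open>v\<close>, so every point \<open>v\<close>, color and atom gives a linear functional in \<open>u\<close>. A random sample of
  these functionals cuts the space into cones; the cone containing a point is spanned by boundedly many
  extreme rays, each fixed by boundedly many sampled functionals, so a union bound over such cones shows
  that only a small fraction of all functionals change sign strictly on the cone of any given point.
  Refine by the signs of the functionals at all rays used: this bounds the number of labels
  polynomially, and whether \<open>v\<close> crosses the cone of \<open>u\<close>, as well as the color of \<open>uv\<close> if it does not, then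
  depends only on the labels of \<open>u\<close> and \<open>v\<close>. Cutting \<open>V\<close>, sorted by label, into \<open>K\<close> consecutive blocks
  leaves few blocks with several labels, hence few incomplete pairs.
\<close>

section \<open>The inner product of coefficient vectors\<close>

text \<open>The obstacle is that a full cell of the sampled arrangement may have unboundedly many
  extreme rays, whereas the sampling argument pays for every sampled functional that a cell depends
  on. Hence a point gets only a subcone of its closed cell, spanned by at most 2 ^ d rays, where d
  is the dimension of the space of polynomials of degree at most t. Such a subcone reads at most 2 ^
  d * d sampled functionals, so the rest of the sample is independent of it. Subcones of different
  points may overlap: only the map from points to subcones matters, and no decomposition of space is
  needed. With r = 32 t m / \<epsilon>, a sample of about r^2 functionals brings the crossing
  fraction down to 1 / r. As each v carries m t functionals, the cone of u is crossed by those of at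
  most an \<epsilon> / 32 fraction of the points. The dimension depends on t and on the number of
  variables, so everything happens in spans of finite sets inside one infinite-dimensional inner
  product space.\<close>

instantiation poly_mapping :: (type, real_inner) real_inner
begin

lift_definition scaleR_poly_mapping :: "real \<Rightarrow> ('a \<Rightarrow>\<^sub>0 'b) \<Rightarrow> 'a \<Rightarrow>\<^sub>0 'b" is "\<lambda>r f k. r *\<^sub>R f k"
  by (erule finite_subset[rotated]) auto

definition inner_poly_mapping :: "('a \<Rightarrow>\<^sub>0 'b) \<Rightarrow> ('a \<Rightarrow>\<^sub>0 'b) \<Rightarrow> real" where
  "inner_poly_mapping p q = (\<Sum>k\<in>Poly_Mapping.keys p. Poly_Mapping.lookup p k \<bullet> Poly_Mapping.lookup q k)"

definition norm_poly_mapping :: "('a \<Rightarrow>\<^sub>0 'b) \<Rightarrow> real" where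
  "norm_poly_mapping p = sqrt (p \<bullet> p)"

definition sgn_poly_mapping :: "('a \<Rightarrow>\<^sub>0 'b) \<Rightarrow> 'a \<Rightarrow>\<^sub>0 'b" where
  "sgn_poly_mapping p = inverse (norm p) *\<^sub>R p"

definition dist_poly_mapping :: "('a \<Rightarrow>\<^sub>0 'b) \<Rightarrow> ('a \<Rightarrow>\<^sub>0 'b) \<Rightarrow> real" where
  "dist_poly_mapping p q = norm (p - q)"

definition uniformity_poly_mapping :: "(('a \<Rightarrow>\<^sub>0 'b) \<times> ('a \<Rightarrow>\<^sub>0 'b)) filter" where
  "uniformity_poly_mapping = (INF e\<in>{0<..}. principal {(x, y). dist x y < e})"

definition open_poly_mapping :: "('a \<Rightarrow>\<^sub>0 'b) set \<Rightarrow> bool" where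
  "open_poly_mapping U \<longleftrightarrow> (\<forall>x\<in>U. \<forall>\<^sub>F (x', y) in uniformity. x' = x \<longrightarrow> y \<in> U)"

text \<open>The defining sum runs over the keys of the first argument only; symmetry and additivity
  need sums over a common index set.\<close>

lemma inner_poly_mapping_superset:
  assumes "finite K" "Poly_Mapping.keys p \<subseteq> K"
  shows "p \<bullet> q = (\<Sum>k\<in>K. Poly_Mapping.lookup p k \<bullet> Poly_Mapping.lookup q k)"
  unfolding inner_poly_mapping_def using assms
  by (intro sum.mono_neutral_left) (auto simp: in_keys_iff)

instance
proof
  fix p q s :: "'a \<Rightarrow>\<^sub>0 'b" and r r' :: real
  show "r *\<^sub>R (p + q) = r *\<^sub>R p + r *\<^sub>R q" "(r + r') *\<^sub>R p = r *\<^sub>R p + r' *\<^sub>R p"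
    "r *\<^sub>R r' *\<^sub>R p = (r * r') *\<^sub>R p" "1 *\<^sub>R p = p"
    by (transfer, simp add: scaleR_add_right scaleR_add_left)+
  show "sgn p = inverse (norm p) *\<^sub>R p" "dist p q = norm (p - q)"
    "uniformity = (INF e\<in>{0<..}. principal {(x, y :: 'a \<Rightarrow>\<^sub>0 'b). dist x y < e})"
    "open U \<longleftrightarrow> (\<forall>x\<in>U. \<forall>\<^sub>F (x', y) in uniformity. x' = x \<longrightarrow> y \<in> U)" for U :: "('a \<Rightarrow>\<^sub>0 'b) set"
    by (rule sgn_poly_mapping_def dist_poly_mapping_def uniformity_poly_mapping_def open_poly_mapping_def)+
  define K where "K = Poly_Mapping.keys p \<union> Poly_Mapping.keys q"
  have K: "finite K" by (simp add: K_def)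
  have scale: "Poly_Mapping.lookup (r *\<^sub>R p) k = r *\<^sub>R Poly_Mapping.lookup p k" for k
    by transfer simp
  have p: "p \<bullet> u = (\<Sum>k\<in>K. Poly_Mapping.lookup p k \<bullet> Poly_Mapping.lookup u k)"
    and q: "q \<bullet> u = (\<Sum>k\<in>K. Poly_Mapping.lookup q k \<bullet> Poly_Mapping.lookup u k)"
    and pq: "(p + q) \<bullet> u = (\<Sum>k\<in>K. Poly_Mapping.lookup (p + q) k \<bullet> Poly_Mapping.lookup u k)"
    and rp: "(r *\<^sub>R p) \<bullet> u = (\<Sum>k\<in>K. Poly_Mapping.lookup (r *\<^sub>R p) k \<bullet> Poly_Mapping.lookup u k)" for u
    using Poly_Mapping.keys_add[of p q] K
    by (intro inner_poly_mapping_superset; auto simp: K_def in_keys_iff scale)+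
  show "p \<bullet> q = q \<bullet> p"
    unfolding p[of q] q[of p] by (intro sum.cong inner_commute refl)
  show "(p + q) \<bullet> s = p \<bullet> s + q \<bullet> s"
    unfolding p[of s] q[of s] pq[of s] by (simp add: lookup_add inner_add_left sum.distrib)
  show "r *\<^sub>R p \<bullet> q = r * (p \<bullet> q)"
    unfolding p[of q] rp[of q] by (simp add: scale sum_distrib_left)
  show "0 \<le> p \<bullet> p"
    unfolding inner_poly_mapping_def by (intro sum_nonneg) auto
  have "p \<bullet> p = 0 \<longleftrightarrow> (\<forall>k\<in>Poly_Mapping.keys p. Poly_Mapping.lookup p k = 0)"
    unfolding inner_poly_mapping_def by (subst sum_nonneg_eq_0_iff) auto
  also have "\<dots> \<longleftrightarrow> p = 0"
    by (metis in_keys_iff lookup_zero poly_mapping_eqI)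
  finally show "p \<bullet> p = 0 \<longleftrightarrow> p = 0" .
  show "norm p = sqrt (p \<bullet> p)" by (rule norm_poly_mapping_def)
qed

end

lemma lookup_scaleR_poly_mapping [simp]:
  "Poly_Mapping.lookup (r *\<^sub>R p) k = r *\<^sub>R Poly_Mapping.lookup p k"
  by transfer simp

lemma inner_single_left [simp]:
  "Poly_Mapping.single k a \<bullet> p = a \<bullet> Poly_Mapping.lookup p k"
  by (simp add: inner_poly_mapping_def)

section \<open>Decomposing a point of a cone into extreme rays\<close>

text \<open>The weak inequalities place \<open>y\<close> in the closed face of the arrangement
  \<open>W\<close> that has \<open>x\<close> in its relative interior; functionals tight at
  \<open>x\<close> stay tight at \<open>y\<close>.\<close>

definition sign_compatible :: "'a::real_inner set \<Rightarrow> 'a \<Rightarrow> 'a \<Rightarrow> bool" where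
  "sign_compatible W x y \<longleftrightarrow>
     (\<forall>w\<in>W. (w \<bullet> x \<ge> 0 \<longrightarrow> w \<bullet> y \<ge> 0) \<and> (w \<bullet> x \<le> 0 \<longrightarrow> w \<bullet> y \<le> 0))"

text \<open>Extremality as a rank condition: within \<open>U\<close>, the functionals tight at
  \<open>y\<close> determine \<open>y\<close> up to a scalar. Unlike indecomposability, this form
  leads directly to an encoding of \<open>y\<close> by few functionals.\<close>

definition extreme_ray :: "'a::real_inner set \<Rightarrow> 'a set \<Rightarrow> 'a \<Rightarrow> bool" where
  "extreme_ray W U y \<longleftrightarrow> y \<in> U \<and> y \<noteq> 0 \<and>
     (\<forall>z\<in>U. (\<forall>w\<in>W. w \<bullet> y = 0 \<longrightarrow> w \<bullet> z = 0) \<longrightarrow> (\<exists>c. z = c *\<^sub>R y))"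

lemma sign_compatible_trans:
  "sign_compatible W x y \<Longrightarrow> sign_compatible W y z \<Longrightarrow> sign_compatible W x z"
  unfolding sign_compatible_def by blast

lemma sign_compatible_scaleR:
  assumes "sign_compatible W x y" "a \<ge> 0"
  shows "sign_compatible W x (a *\<^sub>R y)"
  using assms unfolding sign_compatible_def
  by (simp add: mult_nonneg_nonpos)

lemma extreme_ray_scaleR:
  assumes "extreme_ray W U y" "a > 0" "subspace U"
  shows "extreme_ray W U (a *\<^sub>R y)"
  unfolding extreme_ray_def
proof (intro conjI ballI impI)
  show "a *\<^sub>R y \<in> U" "a *\<^sub>R y \<noteq> 0"
    using assms by (auto simp: extreme_ray_def subspace_scale)
  fix z assume z: "z \<in> U" "\<forall>w\<in>W. w \<bullet> a *\<^sub>R y = 0 \<longrightarrow> w \<bullet> z = 0"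
  then have "\<forall>w\<in>W. w \<bullet> y = 0 \<longrightarrow> w \<bullet> z = 0" by simp
  then obtain c where "z = c *\<^sub>R y" using assms z unfolding extreme_ray_def by blast
  then have "z = (c / a) *\<^sub>R (a *\<^sub>R y)" using assms by simp
  then show "\<exists>c. z = c *\<^sub>R a *\<^sub>R y" by blast
qed

text \<open>The point moves from \<open>x\<close> along \<open>z\<close> until the first functional
  that was nonzero at \<open>x\<close> vanishes: \<open>N\<close> collects the functionals driven
  towards 0, \<open>f\<close> their hitting times. By \<open>T\<close> the functionals tight at
  \<open>x\<close> stay tight, and the new one is not constant along \<open>z\<close>, hence
  independent of them.\<close>

lemma exit_point:
  fixes x z :: "'a::real_inner"
  assumes W: "finite W" and w: "w \<in> W" "(w \<bullet> x) * (w \<bullet> z) < 0"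
    and T: "\<And>w. w \<in> W \<Longrightarrow> w \<bullet> x = 0 \<Longrightarrow> w \<bullet> z = 0"
  obtains r w' where "r > 0" "sign_compatible W x (x + r *\<^sub>R z)"
    "w' \<in> W" "w' \<bullet> (x + r *\<^sub>R z) = 0" "w' \<bullet> z \<noteq> 0"
proof -
  define N where "N = {w\<in>W. (w \<bullet> x) * (w \<bullet> z) < 0}"
  define f where "f = (\<lambda>w. - (w \<bullet> x) / (w \<bullet> z))"
  have N: "finite N" "w \<in> N" using assms by (auto simp: N_def)
  define r where "r = Min (f ` N)"
  have rin: "r \<in> f ` N" unfolding r_def using N by (intro Min_in) auto
  then obtain w' where w': "w' \<in> N" "r = f w'" by blast
  have le: "r \<le> f v" if "v \<in> N" for v
    unfolding r_def using N that by auto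
  have nz: "w' \<in> W" "w' \<bullet> z \<noteq> 0" "w' \<bullet> x \<noteq> 0" using w' by (auto simp: N_def)
  have r0: "r > 0" using w' unfolding N_def f_def
    by (auto simp: mult_less_0_iff divide_pos_neg divide_neg_pos)
  have "sign_compatible W x (x + r *\<^sub>R z)"
    unfolding sign_compatible_def
  proof (intro ballI)
    fix v assume v: "v \<in> W"
    have e: "v \<bullet> (x + r *\<^sub>R z) = v \<bullet> x + r * (v \<bullet> z)" by (simp add: inner_simps)
    consider "v \<bullet> x = 0" | "v \<bullet> x > 0" "v \<bullet> z \<ge> 0" | "v \<bullet> x < 0" "v \<bullet> z \<le> 0"
      | "v \<bullet> x > 0" "v \<bullet> z < 0" | "v \<bullet> x < 0" "v \<bullet> z > 0" by linarith
    then show "(0 \<le> v \<bullet> x \<longrightarrow> 0 \<le> v \<bullet> (x + r *\<^sub>R z)) \<and> (v \<bullet> x \<le> 0 \<longrightarrow> v \<bullet> (x + r *\<^sub>R z) \<le> 0)"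
    proof cases
      case 1 then show ?thesis using T[OF v] e by simp
    next
      case 2 then show ?thesis using r0 e by simp
    next
      case 3 then show ?thesis using r0 e
        by (simp add: mult_nonneg_nonpos add_nonpos_nonpos)
    next
      case 4
      then have "v \<in> N" using v by (simp add: N_def mult_less_0_iff)
      from le[OF this] 4 have "r * (v \<bullet> z) \<ge> - (v \<bullet> x)"
        by (simp add: f_def field_simps)
      then show ?thesis using 4 e by simp
    next
      case 5
      then have "v \<in> N" using v by (simp add: N_def mult_less_0_iff)
      from le[OF this] 5 have "r * (v \<bullet> z) \<le> - (v \<bullet> x)"
        by (simp add: f_def field_simps)
      then show ?thesis using 5 e by simp
    qed
  qed
  moreover have "w' \<bullet> (x + r *\<^sub>R z) = 0" using nz w' by (simp add: f_def inner_simps)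
  ultimately show ?thesis using that[OF r0 _ nz(1) _ nz(2)] by simp
qed

text \<open>
  The sum \<open>l y\<close> below equals the sum of the \<open>\<bar>w \<bullet> y\<bar>\<close> on the cone. Choosing \<open>z\<close> with \<open>l z = 0\<close> keeps it
  constant along the line through \<open>x\<close> in direction \<open>z\<close>, so this line leaves the cone on both sides.
\<close>

lemma split_along_face:
  fixes B W :: "'a::real_inner set"
  assumes W: "finite W"
    and pointed: "\<forall>x\<in>span B. (\<forall>w\<in>W. w \<bullet> x = 0) \<longrightarrow> x = 0"
    and x: "x \<in> span B" "x \<noteq> 0" "\<not> extreme_ray W (span B) x"
  shows "\<exists>z r r'. z \<in> span B \<and> (\<forall>w\<in>W. w \<bullet> x = 0 \<longrightarrow> w \<bullet> z = 0) \<and>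
    r > 0 \<and> sign_compatible W x (x + r *\<^sub>R z) \<and> x + r *\<^sub>R z \<noteq> 0 \<and>
    (\<exists>w\<in>W. w \<bullet> (x + r *\<^sub>R z) = 0 \<and> w \<bullet> z \<noteq> 0) \<and>
    r' > 0 \<and> sign_compatible W x (x - r' *\<^sub>R z) \<and> x - r' *\<^sub>R z \<noteq> 0 \<and>
    (\<exists>w\<in>W. w \<bullet> (x - r' *\<^sub>R z) = 0 \<and> w \<bullet> z \<noteq> 0)"
proof -
  obtain z0 where z0: "z0 \<in> span B" "\<forall>w\<in>W. w \<bullet> x = 0 \<longrightarrow> w \<bullet> z0 = 0" "\<forall>c. z0 \<noteq> c *\<^sub>R x"
    using x unfolding extreme_ray_def by blast
  define l where "l = (\<lambda>y. \<Sum>w\<in>W. sgn (w \<bullet> x) * (w \<bullet> y))"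
  have l_add: "l (y + c *\<^sub>R y') = l y + c * l y'" for y y' c
    unfolding l_def by (simp add: inner_simps sum.distrib sum_distrib_left algebra_simps)
  have l_x: "l x > 0"
  proof -
    obtain w where w: "w \<in> W" "w \<bullet> x \<noteq> 0" using pointed x by blast
    have "l x = (\<Sum>w\<in>W. \<bar>w \<bullet> x\<bar>)" unfolding l_def by (simp add: abs_sgn mult.commute)
    also have "\<dots> > 0" using w W by (intro sum_pos2[of _ w]) auto
    finally show ?thesis .
  qed
  define z where "z = z0 + (- l z0 / l x) *\<^sub>R x"
  have zU: "z \<in> span B" using z0 x by (auto simp: z_def intro!: span_add span_scale span_diff)
  have lz: "l z = 0" using l_x l_add[of z0 "- l z0 / l x" x] unfolding z_def by simp
  have Tz: "w \<bullet> z = 0" if "w \<in> W" "w \<bullet> x = 0" for w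
    using z0 that by (simp add: z_def inner_simps)
  have "z \<noteq> 0"
  proof
    assume "z = 0"
    then have "z0 = (l z0 / l x) *\<^sub>R x" by (simp add: z_def)
    then show False using z0(3) by blast
  qed
  then obtain v where v: "v \<in> W" "v \<bullet> z \<noteq> 0" using pointed zU by blast
  then have vx: "v \<bullet> x \<noteq> 0" using Tz by blast
  \<comment> \<open>The sum \<open>l y\<close> is 0 but has a nonzero term at \<open>v\<close>, so
    some term is negative. Applied to \<open>z\<close> and to \<open>- z\<close>, this yields an
    exit on both sides.\<close>
  have neg: "\<exists>w\<in>W. (w \<bullet> x) * (w \<bullet> y) < 0" if "l y = 0" "v \<bullet> y \<noteq> 0" for y
  proof (rule ccontr)
    assume "\<not> ?thesis"
    then have n: "(w \<bullet> x) * (w \<bullet> y) \<ge> 0" if "w \<in> W" for w using that by (meson not_less)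
    have "sgn (w \<bullet> x) * (w \<bullet> y) \<ge> 0" if "w \<in> W" for w
      using n[OF that] by (auto simp: sgn_if zero_le_mult_iff)
    moreover have "sgn (v \<bullet> x) * (v \<bullet> y) \<noteq> 0" using vx that by (simp add: sgn_0_0)
    ultimately have "l y > 0" unfolding l_def using W v by (intro sum_pos2[of _ v]) (auto simp: order_less_le)
    then show False using that by simp
  qed
  have lneg: "l (- z) = 0" using l_add[of 0 "-1" z] lz by (simp add: l_def)
  obtain w1 where w1: "w1 \<in> W" "(w1 \<bullet> x) * (w1 \<bullet> z) < 0" using neg lz v by blast
  obtain w2 where w2: "w2 \<in> W" "(w2 \<bullet> x) * (w2 \<bullet> (- z)) < 0" using neg[of "- z"] lneg v by auto
  obtain r w where e1: "r > 0" "sign_compatible W x (x + r *\<^sub>R z)"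
    "w \<in> W" "w \<bullet> (x + r *\<^sub>R z) = 0" "w \<bullet> z \<noteq> 0"
    using exit_point[OF W w1 Tz] by metis
  have Tz': "w \<bullet> (- z) = 0" if "w \<in> W" "w \<bullet> x = 0" for w using Tz that by simp
  obtain r' w' where e2: "r' > 0" "sign_compatible W x (x + r' *\<^sub>R (- z))"
    "w' \<in> W" "w' \<bullet> (x + r' *\<^sub>R (- z)) = 0" "w' \<bullet> (- z) \<noteq> 0"
    using exit_point[OF W w2 Tz'] by metis
  have nz: "x + c *\<^sub>R z \<noteq> 0" for c
  proof
    assume "x + c *\<^sub>R z = 0"
    then have "l (x + c *\<^sub>R z) = l 0" by simp
    then show False using l_add[of x c z] l_x lz by (simp add: l_def)
  qed
  \<comment> \<open>On the whole line \<open>l\<close> has the positive value \<open>l x\<close>, so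
    neither exit point is 0.\<close>
  have "x - r' *\<^sub>R z \<noteq> 0" using nz[of "- r'"] by simp
  moreover have "sign_compatible W x (x - r' *\<^sub>R z)" "w' \<bullet> (x - r' *\<^sub>R z) = 0" "w' \<bullet> z \<noteq> 0"
    using e2 by simp_all
  ultimately have "\<exists>w\<in>W. w \<bullet> (x - r' *\<^sub>R z) = 0 \<and> w \<bullet> z \<noteq> 0"
      "\<exists>w\<in>W. w \<bullet> (x + r *\<^sub>R z) = 0 \<and> w \<bullet> z \<noteq> 0"
      "sign_compatible W x (x - r' *\<^sub>R z)"
      "\<forall>w\<in>W. w \<bullet> x = 0 \<longrightarrow> w \<bullet> z = 0"
    using e1(3-5) e2(3) Tz by blast+
  then show ?thesis using zU e1(1,2) nz[of r] e2(1) \<open>x - r' *\<^sub>R z \<noteq> 0\<close>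
    by (metis (lifting))
qed

text \<open>\<open>z\<close> is orthogonal to \<open>span A\<close> but not to \<open>w\<close>.
  This is how the rank of the tight functionals grows at an exit point.\<close>

lemma independent_insert_not_annihilated:
  fixes A :: "'a::real_inner set"
  assumes "independent A" "\<And>a. a \<in> A \<Longrightarrow> a \<bullet> z = 0" "w \<bullet> z \<noteq> 0"
  shows "independent (insert w A)" "w \<notin> A"
proof -
  have "a \<bullet> z = 0" if "a \<in> span A" for a
    using that
    by (induction rule: span_induct) (auto simp: subspace_def inner_simps assms(2))
  then have "w \<notin> span A" using assms(3) by blast
  then show "independent (insert w A)" "w \<notin> A"
    using assms(1) span_base[of w A] by (auto simp: independent_insert)
qed

text \<open>Induction on \<open>k\<close>, a bound on the corank of the functionals tight at
  \<open>x\<close>; \<open>A\<close> is an independent set of such functionals. A point that is not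
  extreme is a convex combination of two exit points, at each of which one more independent
  functional is tight, so the binary splitting has depth at most \<open>k\<close>. The bound 2 ^ k
  is weaker than Caratheodory's, but it only has to be independent of \<open>W\<close>.\<close>

lemma decompose_into_rays_of_face:
  fixes B W :: "'a::real_inner set"
  assumes B: "finite B" and W: "finite W" "W \<subseteq> span B"
    and pointed: "\<forall>x\<in>span B. (\<forall>w\<in>W. w \<bullet> x = 0) \<longrightarrow> x = 0"
  shows "x \<in> span B \<Longrightarrow> x \<noteq> 0 \<Longrightarrow> A \<subseteq> {w\<in>W. w \<bullet> x = 0} \<Longrightarrow> independent A \<Longrightarrow>
    card B \<le> card A + k \<Longrightarrow>
    \<exists>ys. length ys \<le> 2 ^ k \<and> x = sum_list ys \<and>
      (\<forall>y\<in>set ys. extreme_ray W (span B) y \<and> sign_compatible W x y)"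
proof (induction k arbitrary: x A rule: less_induct)
  case (less k x A)
  show ?case
  proof (cases "extreme_ray W (span B) x")
    case True
    then show ?thesis by (intro exI[of _ "[x]"]) (auto simp: sign_compatible_def)
  next
    case False
    obtain z r r' where z: "z \<in> span B" "\<forall>w\<in>W. w \<bullet> x = 0 \<longrightarrow> w \<bullet> z = 0" and
      e1: "r > 0" "sign_compatible W x (x + r *\<^sub>R z)" "x + r *\<^sub>R z \<noteq> 0"
        "\<exists>w\<in>W. w \<bullet> (x + r *\<^sub>R z) = 0 \<and> w \<bullet> z \<noteq> 0" and
      e1': "r' > 0" "sign_compatible W x (x - r' *\<^sub>R z)" "x - r' *\<^sub>R z \<noteq> 0"
        "\<exists>w\<in>W. w \<bullet> (x - r' *\<^sub>R z) = 0 \<and> w \<bullet> z \<noteq> 0"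
      using split_along_face[OF W(1) pointed less.prems(1,2) False] by (elim exE conjE) (rule that)
    from e1(4) obtain w where w: "w \<in> W" "w \<bullet> (x + r *\<^sub>R z) = 0" "w \<bullet> z \<noteq> 0" by blast
    note e = e1(1-3) w
    from e1'(4) obtain w' where w': "w' \<in> W" "w' \<bullet> (x - r' *\<^sub>R z) = 0" "w' \<bullet> z \<noteq> 0" by blast
    note e' = e1'(1-3) w'
    have Az: "a \<bullet> z = 0" if "a \<in> A" for a using that z(2) less.prems(3) by auto
    have finA: "finite A" by (rule finite_subset[OF less.prems(3)]) (simp add: W)
    \<comment> \<open>Since \<open>x\<close> is not extreme, \<open>span B\<close> has room for one
      more independent functional; this excludes \<open>k = 0\<close>.\<close>
    have card_ins: "card (insert v A) = Suc (card A)" "independent (insert v A)" "k > 0"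
      if "v \<in> W" "v \<bullet> z \<noteq> 0" for v
    proof -
      note * = independent_insert_not_annihilated[OF less.prems(4) Az that(2)]
      then show **: "card (insert v A) = Suc (card A)" "independent (insert v A)" using finA by auto
      have "insert v A \<subseteq> span B" using that W less.prems(3) by auto
      then show "k > 0" using independent_span_bound[OF B *(1)] ** less.prems(5) by auto
    qed
    have k: "k - 1 < k" using card_ins(3) e by simp
    have "\<exists>ys. length ys \<le> 2 ^ (k - 1) \<and> x + r *\<^sub>R z = sum_list ys \<and>
      (\<forall>y\<in>set ys. extreme_ray W (span B) y \<and> sign_compatible W (x + r *\<^sub>R z) y)"
      using e z card_ins[OF e(4,6)] less.prems Az
      by (intro less.IH[OF k, of "x + r *\<^sub>R z" "insert w A"])
        (auto simp: span_add span_scale inner_add_right)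
    then obtain ys where ys: "length ys \<le> 2 ^ (k - 1)" "x + r *\<^sub>R z = sum_list ys"
      "\<forall>y\<in>set ys. extreme_ray W (span B) y \<and> sign_compatible W (x + r *\<^sub>R z) y" by blast
    have "\<exists>ys. length ys \<le> 2 ^ (k - 1) \<and> x - r' *\<^sub>R z = sum_list ys \<and>
      (\<forall>y\<in>set ys. extreme_ray W (span B) y \<and> sign_compatible W (x - r' *\<^sub>R z) y)"
      using e' z card_ins[OF e'(4,6)] less.prems Az
      by (intro less.IH[OF k, of "x - r' *\<^sub>R z" "insert w' A"])
        (auto simp: span_diff span_scale inner_diff_right)
    then obtain ys' where ys': "length ys' \<le> 2 ^ (k - 1)" "x - r' *\<^sub>R z = sum_list ys'"
      "\<forall>y\<in>set ys'. extreme_ray W (span B) y \<and> sign_compatible W (x - r' *\<^sub>R z) y" by blast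
    \<comment> \<open>\<open>x\<close> divides the segment between the two exit points in the ratio
      \<open>r : r'\<close>, which gives the weights.\<close>
    define zs where "zs = map ((*\<^sub>R) (r' / (r + r'))) ys @ map ((*\<^sub>R) (r / (r + r'))) ys'"
    have "length zs \<le> 2 ^ (k - 1) + 2 ^ (k - 1)" using ys ys' by (simp add: zs_def)
    also have "\<dots> = 2 ^ k" using k by (cases k) auto
    finally have len: "length zs \<le> 2 ^ k" .
    have scale: "sum_list (map ((*\<^sub>R) c) us) = c *\<^sub>R sum_list us" for c :: real and us :: "'a list"
      by (induction us) (auto simp: scaleR_right_distrib)
    have "sum_list zs = (r' / (r + r')) *\<^sub>R (x + r *\<^sub>R z) + (r / (r + r')) *\<^sub>R (x - r' *\<^sub>R z)"
      by (simp add: zs_def scale ys(2) ys'(2))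
    also have "\<dots> = (r' / (r + r') + r / (r + r')) *\<^sub>R x"
      by (simp add: algebra_simps)
    also have "\<dots> = x" using e(1) e'(1) by (simp add: add.commute flip: add_divide_distrib)
    finally have sum: "x = sum_list zs" by simp
    have "extreme_ray W (span B) y \<and> sign_compatible W x y" if "y \<in> set zs" for y
    proof -
      from that consider (1) u where "u \<in> set ys" "y = (r' / (r + r')) *\<^sub>R u"
        | (2) u where "u \<in> set ys'" "y = (r / (r + r')) *\<^sub>R u"
        by (auto simp: zs_def)
      then show ?thesis
      proof cases
        case 1
        then have "extreme_ray W (span B) u" "sign_compatible W x u"
          using ys(3) sign_compatible_trans[OF e(2)] by auto
        then show ?thesis using 1 e(1) e'(1)
          by (simp add: extreme_ray_scaleR sign_compatible_scaleR)
      next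
        case 2
        then have "extreme_ray W (span B) u" "sign_compatible W x u"
          using ys'(3) sign_compatible_trans[OF e'(2)] by auto
        then show ?thesis using 2 e(1) e'(1)
          by (simp add: extreme_ray_scaleR sign_compatible_scaleR)
      qed
    qed
    then show ?thesis using len sum by blast
  qed
qed

lemma decompose_into_rays:
  fixes B W :: "'a::real_inner set"
  assumes "finite B" "finite W" "W \<subseteq> span B"
    and "\<forall>x\<in>span B. (\<forall>w\<in>W. w \<bullet> x = 0) \<longrightarrow> x = 0"
    and "x \<in> span B" "x \<noteq> 0"
  shows "\<exists>ys. length ys \<le> 2 ^ card B \<and> x = sum_list ys \<and>
    (\<forall>y\<in>set ys. extreme_ray W (span B) y \<and> sign_compatible W x y)"
  by (rule decompose_into_rays_of_face[OF assms, of "{}"]) (simp_all add: independent_empty)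

section \<open>Rays cut out by few functionals\<close>

definition ray_of :: "'a::real_inner set \<Rightarrow> 'a set \<Rightarrow> 'a" where
  "ray_of U A = (if \<exists>y\<in>U. y \<noteq> 0 \<and> (\<forall>w\<in>A. w \<bullet> y = 0)
     then SOME y. y \<in> U \<and> y \<noteq> 0 \<and> (\<forall>w\<in>A. w \<bullet> y = 0) else 0)"

lemma ray_of:
  assumes "\<exists>y\<in>U. y \<noteq> 0 \<and> (\<forall>w\<in>A. w \<bullet> y = 0)"
  shows "ray_of U A \<in> U \<and> ray_of U A \<noteq> 0 \<and> (\<forall>w\<in>A. w \<bullet> ray_of U A = 0)"
proof -
  have "\<exists>y. y \<in> U \<and> y \<noteq> 0 \<and> (\<forall>w\<in>A. w \<bullet> y = 0)" using assms by blast
  from someI_ex[OF this] show ?thesis using assms by (simp add: ray_of_def)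
qed

text \<open>The default value 0 makes this unconditional, so that codes with trivial common kernel
  still denote vectors of \<open>U\<close>.\<close>

lemma ray_of_in: "subspace U \<Longrightarrow> ray_of U A \<in> U"
  using ray_of[of U A] by (cases "\<exists>y\<in>U. y \<noteq> 0 \<and> (\<forall>w\<in>A. w \<bullet> y = 0)")
    (auto simp: ray_of_def subspace_0)

text \<open>A maximal independent subset \<open>A\<close> of the functionals tight at
  \<open>y\<close> has at most \<open>card B\<close> elements and the same annihilator. The vector
  chosen for \<open>A\<close> is therefore annihilated by all tight functionals, and extremality
  forces it onto the line of \<open>y\<close>.\<close>

lemma extreme_ray_eq_ray_of:
  fixes B W :: "'a::real_inner set"
  assumes B: "finite B" "W \<subseteq> span B" and y: "extreme_ray W (span B) y"
  obtains A c where "A \<subseteq> W" "finite A" "card A \<le> card B" "c \<noteq> 0" "y = c *\<^sub>R ray_of (span B) A"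
proof -
  define T where "T = {w\<in>W. w \<bullet> y = 0}"
  obtain A where A: "A \<subseteq> T" "independent A" "T \<subseteq> span A" by (rule maximal_independent_subset)
  have AB: "A \<subseteq> span B" "A \<subseteq> W" using A B by (auto simp: T_def)
  then have card: "finite A" "card A \<le> card B" using independent_span_bound[OF B(1) A(2)] by auto
  have TA: "w \<bullet> z = 0" if "\<forall>a\<in>A. a \<bullet> z = 0" "w \<in> T" for w z
  proof -
    have "w \<in> span A" using A that by blast
    then show ?thesis
      by (induction rule: span_induct) (use that in \<open>auto simp: subspace_def inner_simps\<close>)
  qed
  have ex: "\<exists>y\<in>span B. y \<noteq> 0 \<and> (\<forall>w\<in>A. w \<bullet> y = 0)"
    using y A by (auto simp: T_def extreme_ray_def)
  define g where "g = ray_of (span B) A"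
  have "g \<in> span B \<and> g \<noteq> 0 \<and> (\<forall>w\<in>A. w \<bullet> g = 0)"
    unfolding g_def by (rule ray_of[OF ex])
  then have g: "g \<in> span B" "g \<noteq> 0" "\<forall>w\<in>A. w \<bullet> g = 0" by auto
  have "\<forall>w\<in>W. w \<bullet> y = 0 \<longrightarrow> w \<bullet> g = 0" using TA g(3) by (auto simp: T_def)
  then obtain c where c: "g = c *\<^sub>R y" using y g(1) unfolding extreme_ray_def by blast
  then have "c \<noteq> 0" using g by auto
  then show ?thesis using that[of A "inverse c"] AB card c by (simp add: g_def)
qed

section \<open>Random sampling and weak cuttings\<close>

text \<open>Counting in place of probability. Fixing the coordinates in \<open>D\<close> fixes the
  set \<open>X\<close>; each of the other \<open>s - card D\<close> coordinates must then avoid more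
  than \<open>\<delta> * card \<Omega>\<close> elements, which leaves at most
  \<open>(1 - \<delta>) * card \<Omega>\<close> choices.\<close>

lemma card_avoiding_functions:
  fixes X :: "(nat \<Rightarrow> 'w) \<Rightarrow> 'w set" and \<delta> :: real
  assumes \<Omega>: "finite \<Omega>" and \<delta>: "0 \<le> \<delta>" "\<delta> \<le> 1" and D: "D \<subseteq> {..<s}"
    and X: "\<forall>f g. (\<forall>i\<in>D. f i = g i) \<longrightarrow> X f = X g"
  shows "real (card {f \<in> {..<s} \<rightarrow>\<^sub>E \<Omega>. \<delta> * card \<Omega> < card (\<Omega> \<inter> X f) \<and> (\<forall>i<s. f i \<notin> X f)})
    \<le> real (card \<Omega>) ^ s * (1 - \<delta>) ^ (s - card D)" (is "real (card ?Bad) \<le> _")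
proof -
  define fib where "fib = (\<lambda>\<rho>. {f \<in> ?Bad. restrict f D = \<rho>})"
  have finD: "finite D" using D finite_subset by blast
  have cD: "card D \<le> s" using card_mono[OF _ D] by simp
  have finP: "finite (D \<rightarrow>\<^sub>E \<Omega>)" using \<Omega> finD by (intro finite_PiE) auto
  have fib_le: "real (card (fib \<rho>)) \<le> ((1 - \<delta>) * card \<Omega>) ^ (s - card D)" if "\<rho> \<in> D \<rightarrow>\<^sub>E \<Omega>" for \<rho>
  proof (cases "fib \<rho> = {}")
    case True
    then show ?thesis using \<delta> by simp
  next
    case False
    have XX: "X f = X \<rho>" if "f \<in> fib \<rho>" for f
      using that by (intro X[rule_format]) (auto simp: fib_def)
    have sub: "fib \<rho> \<subseteq> PiE {..<s} (\<lambda>i. if i \<in> D then {\<rho> i} else \<Omega> - X \<rho>)"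
    proof
      fix f assume f: "f \<in> fib \<rho>"
      then have "f \<in> {..<s} \<rightarrow>\<^sub>E \<Omega>" "\<forall>i<s. f i \<notin> X \<rho>" "restrict f D = \<rho>"
        using XX[OF f] by (auto simp: fib_def)
      then show "f \<in> PiE {..<s} (\<lambda>i. if i \<in> D then {\<rho> i} else \<Omega> - X \<rho>)"
        by (auto simp: PiE_iff)
    qed
    obtain f where f: "f \<in> fib \<rho>" using False by blast
    then have "\<delta> * card \<Omega> < card (\<Omega> \<inter> X \<rho>)" using XX[OF f] by (simp add: fib_def)
    moreover have "card (\<Omega> - X \<rho>) + card (\<Omega> \<inter> X \<rho>) = card \<Omega>"
      using card_Diff_subset_Int[of \<Omega> "X \<rho>"] card_mono[of \<Omega> "\<Omega> \<inter> X \<rho>"] \<Omega> by auto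
    ultimately have le: "real (card (\<Omega> - X \<rho>)) \<le> (1 - \<delta>) * card \<Omega>"
      by (simp add: algebra_simps flip: of_nat_add)
    have "card (fib \<rho>) \<le> card (PiE {..<s} (\<lambda>i. if i \<in> D then {\<rho> i} else \<Omega> - X \<rho>))"
      using \<Omega> by (intro card_mono sub finite_PiE) auto
    also have "\<dots> = (\<Prod>i\<in>{..<s}. if i \<in> D then 1 else card (\<Omega> - X \<rho>))"
      by (subst card_PiE) (auto intro!: prod.cong)
    also have "\<dots> = card (\<Omega> - X \<rho>) ^ card ({..<s} - D)"
    proof -
      have "{..<s} \<inter> - D = {..<s} - D" by auto
      then show ?thesis by (simp add: prod.If_cases)
    qed
    also have "card ({..<s} - D) = s - card D" using D finD by (simp add: card_Diff_subset)
    finally have "real (card (fib \<rho>)) \<le> real (card (\<Omega> - X \<rho>)) ^ (s - card D)"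
      by (metis of_nat_le_iff of_nat_power)
    also have "\<dots> \<le> ((1 - \<delta>) * card \<Omega>) ^ (s - card D)" by (intro power_mono le) auto
    finally show ?thesis .
  qed
  have fin: "finite ?Bad" using \<Omega> by (intro finite_subset[OF _ finite_PiE[of "{..<s}" "\<lambda>_. \<Omega>"]]) auto
  have finfib: "finite (fib \<rho>)" for \<rho>
    unfolding fib_def by (rule finite_subset[OF _ fin]) blast
  have "restrict f D \<in> D \<rightarrow>\<^sub>E \<Omega>" if "f \<in> ?Bad" for f
    using that D by (simp add: PiE_iff subset_eq)
  then have "?Bad \<subseteq> (\<Union>\<rho>\<in>D \<rightarrow>\<^sub>E \<Omega>. fib \<rho>)"
    unfolding fib_def by blast
  then have "card ?Bad \<le> card (\<Union>\<rho>\<in>D \<rightarrow>\<^sub>E \<Omega>. fib \<rho>)"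
    using finfib finP by (intro card_mono) auto
  also have "\<dots> \<le> (\<Sum>\<rho>\<in>D \<rightarrow>\<^sub>E \<Omega>. card (fib \<rho>))" by (rule card_UN_le[OF finP])
  finally have "real (card ?Bad) \<le> (\<Sum>\<rho>\<in>D \<rightarrow>\<^sub>E \<Omega>. real (card (fib \<rho>)))"
    by (simp flip: of_nat_sum)
  also have "\<dots> \<le> (\<Sum>\<rho>\<in>D \<rightarrow>\<^sub>E \<Omega>. ((1 - \<delta>) * card \<Omega>) ^ (s - card D))"
    by (intro sum_mono fib_le)
  also have "\<dots> = real (card \<Omega>) ^ card D * ((1 - \<delta>) * card \<Omega>) ^ (s - card D)"
    using finD by (simp add: card_PiE)
  also have "\<dots> = real (card \<Omega>) ^ (card D + (s - card D)) * (1 - \<delta>) ^ (s - card D)"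
    by (simp add: power_add power_mult_distrib mult_ac)
  finally show ?thesis using cD by simp
qed

text \<open>Union bound: by \<open>few\<close>, the samples that are bad for some
  \<open>\<kappa>\<close> do not exhaust all samples. The set \<open>X \<kappa> f\<close> depends on
  the sample itself, but only through at most \<open>q\<close> positions, which leaves
  \<open>s - q\<close> free trials.\<close>

lemma ex_hitting_sample:
  fixes X :: "'c \<Rightarrow> (nat \<Rightarrow> 'w) \<Rightarrow> 'w set" and \<delta> :: real
  assumes \<Omega>: "finite \<Omega>" "\<Omega> \<noteq> {}" and C: "finite C" and \<delta>: "0 \<le> \<delta>" "\<delta> \<le> 1"
    and dep: "\<And>\<kappa>. \<kappa> \<in> C \<Longrightarrow> dep \<kappa> \<subseteq> {..<s}" "\<And>\<kappa>. \<kappa> \<in> C \<Longrightarrow> card (dep \<kappa>) \<le> q"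
    and X: "\<And>\<kappa>. \<kappa> \<in> C \<Longrightarrow> \<forall>f g. (\<forall>i\<in>dep \<kappa>. f i = g i) \<longrightarrow> X \<kappa> f = X \<kappa> g"
    and few: "real (card C) * (1 - \<delta>) ^ (s - q) < 1"
  shows "\<exists>f\<in>{..<s} \<rightarrow> \<Omega>. \<forall>\<kappa>\<in>C. (\<forall>i<s. f i \<notin> X \<kappa> f) \<longrightarrow> real (card (\<Omega> \<inter> X \<kappa> f)) \<le> \<delta> * card \<Omega>"
proof -
  let ?F = "{..<s} \<rightarrow>\<^sub>E \<Omega>"
  define Bad where "Bad = (\<lambda>\<kappa>. {f \<in> ?F. \<delta> * card \<Omega> < card (\<Omega> \<inter> X \<kappa> f) \<and> (\<forall>i<s. f i \<notin> X \<kappa> f)})"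
  have finF: "finite ?F" using \<Omega> by (intro finite_PiE) auto
  have N: "real (card \<Omega>) > 0" using \<Omega> by (simp add: card_gt_0_iff)
  have Bad_le: "real (card (Bad \<kappa>)) \<le> real (card \<Omega>) ^ s * (1 - \<delta>) ^ (s - q)" if "\<kappa> \<in> C" for \<kappa>
  proof -
    have "real (card (Bad \<kappa>)) \<le> real (card \<Omega>) ^ s * (1 - \<delta>) ^ (s - card (dep \<kappa>))"
      unfolding Bad_def by (rule card_avoiding_functions[OF \<Omega>(1) \<delta> dep(1)[OF that] X[OF that]])
    also have "\<dots> \<le> real (card \<Omega>) ^ s * (1 - \<delta>) ^ (s - q)"
      using dep(2)[OF that] \<delta> N by (intro mult_left_mono power_decreasing) auto
    finally show ?thesis .
  qed
  have "real (card (\<Union>\<kappa>\<in>C. Bad \<kappa>)) \<le> (\<Sum>\<kappa>\<in>C. real (card (Bad \<kappa>)))"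
    using card_UN_le[OF C, of Bad] by (metis of_nat_le_iff of_nat_sum)
  also have "\<dots> \<le> (\<Sum>\<kappa>\<in>C. real (card \<Omega>) ^ s * (1 - \<delta>) ^ (s - q))" by (intro sum_mono Bad_le)
  also have "\<dots> = real (card \<Omega>) ^ s * (real (card C) * (1 - \<delta>) ^ (s - q))" by simp
  also have "\<dots> < real (card \<Omega>) ^ s * 1" using few N by (intro mult_strict_left_mono) auto
  also have "\<dots> = real (card ?F)" by (simp add: card_PiE)
  finally have "card (\<Union>\<kappa>\<in>C. Bad \<kappa>) < card ?F" by simp
  then have "\<not> ?F \<subseteq> (\<Union>\<kappa>\<in>C. Bad \<kappa>)"
    using card_mono[of "\<Union>\<kappa>\<in>C. Bad \<kappa>" ?F] C finF by (force simp: Bad_def not_le[symmetric])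
  then obtain f where "f \<in> ?F" "f \<notin> (\<Union>\<kappa>\<in>C. Bad \<kappa>)" by blast
  then show ?thesis by (intro bexI[of _ f]) (auto simp: Bad_def not_less PiE_iff)
qed

section \<open>Cones given by generators, and the functionals crossing them\<close>

definition in_open_cone :: "'a::real_vector list \<Rightarrow> 'a \<Rightarrow> bool" where
  "in_open_cone ys x \<longleftrightarrow> (\<exists>us. x = sum_list us \<and> list_all2 (\<lambda>u y. \<exists>a>0. u = a *\<^sub>R y) us ys)"

definition crosses :: "'a::real_inner \<Rightarrow> 'a set \<Rightarrow> bool" where
  "crosses h Y \<longleftrightarrow> (\<exists>y\<in>Y. h \<bullet> y > 0) \<and> (\<exists>y\<in>Y. h \<bullet> y < 0)"

lemma inner_sum_list: "h \<bullet> sum_list us = sum_list (map ((\<bullet>) h) us)"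
  by (induction us) (auto simp: inner_add_right)

text \<open>A functional that does not cross has one weak sign on all generators. If that sign is
  nonpositive and strict somewhere, then \<open>h \<bullet> x < 0\<close>, because
  \<open>in_open_cone\<close> demands strictly positive coefficients throughout. So the sign at
  \<open>x\<close> can be read off the generators.\<close>

lemma not_crosses_nonneg_iff:
  assumes "in_open_cone ys x" "\<not> crosses h (set ys)"
  shows "0 \<le> h \<bullet> x \<longleftrightarrow> (\<forall>y\<in>set ys. 0 \<le> h \<bullet> y)"
proof -
  obtain us where us: "x = sum_list us" "list_all2 (\<lambda>u y. \<exists>a>0. u = a *\<^sub>R y) us ys"
    using assms(1) by (auto simp: in_open_cone_def)
  have u_y: "\<exists>y\<in>set ys. \<exists>a>0. u = a *\<^sub>R y" if "u \<in> set us" for u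
    using us(2) that unfolding list_all2_conv_all_nth by (metis in_set_conv_nth)
  have y_u: "\<exists>u\<in>set us. \<exists>a>0. u = a *\<^sub>R y" if "y \<in> set ys" for y
    using us(2) that unfolding list_all2_conv_all_nth by (metis in_set_conv_nth)
  show ?thesis
  proof
    assume *: "\<forall>y\<in>set ys. 0 \<le> h \<bullet> y"
    have "0 \<le> h \<bullet> u" if u: "u \<in> set us" for u
    proof -
      obtain y a where "y \<in> set ys" "a > 0" "u = a *\<^sub>R y" using u_y[OF u] by blast
      then show ?thesis using * by simp
    qed
    then show "0 \<le> h \<bullet> x" unfolding us(1) inner_sum_list by (intro sum_list_nonneg) auto
  next
    assume x: "0 \<le> h \<bullet> x"
    show "\<forall>y\<in>set ys. 0 \<le> h \<bullet> y"
    proof (rule ccontr)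
      assume "\<not> ?thesis"
      then obtain y where y: "y \<in> set ys" "h \<bullet> y < 0" by (auto simp: not_le)
      then have le: "h \<bullet> z \<le> 0" if "z \<in> set ys" for z
        using assms(2) that by (force simp: crosses_def)
      have "h \<bullet> u \<le> 0" if u: "u \<in> set us" for u
      proof -
        obtain z a where "z \<in> set ys" "a > 0" "u = a *\<^sub>R z" using u_y[OF u] by blast
        then show ?thesis using le by (simp add: mult_le_0_iff)
      qed
      moreover obtain u where "u \<in> set us" "h \<bullet> u < 0"
      proof -
        obtain u a where "u \<in> set us" "a > 0" "u = a *\<^sub>R y" using y_u[OF y(1)] by blast
        then show ?thesis using y(2) that by (simp add: mult_less_0_iff)
      qed
      ultimately have "sum_list (map ((\<bullet>) h) us) < 0"
      proof (induction us)
        case (Cons v us)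
        have "sum_list (map ((\<bullet>) h) us) \<le> 0"
          using Cons.prems(1) by (intro sum_list_nonpos) auto
        with Cons show ?case by (cases "h \<bullet> v < 0") (force simp: add_neg_nonpos add_nonpos_neg)+
      qed simp
      then show False using x us(1) by (simp add: inner_sum_list)
    qed
  qed
qed

text \<open>
  Rays are encoded by lists of indices of fixed length: \<open>Inl i\<close> stands for the \<open>i\<close>-th sampled functional,
  \<open>Inr b\<close> for a fixed vector \<open>b\<close>. The basis vectors are added to make the cones pointed, the zero vector
  pads the lists.
\<close>

definition sampled :: "(nat \<Rightarrow> 'a) \<Rightarrow> nat + 'a \<Rightarrow> 'a" where
  "sampled w j = (case j of Inl i \<Rightarrow> w i | Inr b \<Rightarrow> b)"

text \<open>The scalar will be -1, 0 or 1: a sign selects one of the two rays on a line, and 0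
  yields the zero vector that pads lists of generators.\<close>

definition generator :: "'a::real_inner set \<Rightarrow> (nat \<Rightarrow> 'a) \<Rightarrow> (nat + 'a) list \<times> real \<Rightarrow> 'a" where
  "generator U w g = snd g *\<^sub>R ray_of U (sampled w ` set (fst g))"

lemma ray_of_insert_0: "ray_of U (insert 0 A) = ray_of U A"
  by (auto simp: ray_of_def)

text \<open>The factor \<open>\<bar>c\<bar>\<close> stays outside the code: codes must range over a
  finite set, and \<open>in_open_cone\<close> is insensitive to positive scaling of generators.
  Padding with the zero functional imposes no further condition on the ray.\<close>

lemma extreme_ray_eq_generator:
  fixes B :: "'a::real_inner set"
  assumes B: "finite B" and I: "finite I" "Inr 0 \<in> I" "sampled w ` I \<subseteq> span B"
    and y: "extreme_ray (sampled w ` I) (span B) y"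
  shows "\<exists>xs c. set xs \<subseteq> I \<and> length xs = card B \<and> c \<noteq> 0 \<and> y = \<bar>c\<bar> *\<^sub>R generator (span B) w (xs, sgn c)"
proof -
  obtain A c where A: "A \<subseteq> sampled w ` I" "finite A" "card A \<le> card B" "c \<noteq> 0"
    "y = c *\<^sub>R ray_of (span B) A" using extreme_ray_eq_ray_of[OF B I(3) y] by blast
  obtain J where J: "J \<subseteq> I" "inj_on (sampled w) J" "A = sampled w ` J"
    using A(1) by (auto simp: subset_image_inj)
  have cJ: "finite J" "card J \<le> card B" using J A(3) I(1) by (auto simp: card_image intro: finite_subset)
  obtain zs where zs: "set zs = J" "length zs = card J" using finite_distinct_list[OF cJ(1)] distinct_card by metis
  define xs where "xs = zs @ replicate (card B - card J) (Inr 0)"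
  have "sampled w ` set xs = A \<or> sampled w ` set xs = insert 0 A"
    using zs J(3) by (auto simp: xs_def sampled_def)
  then have "ray_of (span B) (sampled w ` set xs) = ray_of (span B) A"
    using ray_of_insert_0 by metis
  then have "y = \<bar>c\<bar> *\<^sub>R generator (span B) w (xs, sgn c)"
    using A(5) by (simp add: generator_def abs_mult_sgn)
  moreover have "set xs \<subseteq> I" "length xs = card B"
    using zs J(1) cJ(2) I(2) by (auto simp: xs_def)
  ultimately show ?thesis using A(4) by blast
qed

text \<open>Candidate cones are tuples \<open>\<kappa>\<close> of 2 ^ d generator codes. The cone
  chosen for \<open>x\<close> lies in the closed face of \<open>x\<close>, so no sampled functional
  crosses it, and a sample from \<open>ex_hitting_sample\<close> then guarantees few crossings among
  all of \<open>\<Omega>\<close>. The cutting is weak in that cones of different points may overlap;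
  they only share the pool \<open>G\<close> of rays. Closure of \<open>G\<close> under negation
  later turns weak sign data into strict signs.\<close>

lemma weak_cutting:
  fixes B :: "'a::real_inner set" and h :: "'w \<Rightarrow> 'a" and \<delta> :: real
  defines "d \<equiv> card B"
  assumes B: "finite B" and \<Omega>: "finite \<Omega>" "\<Omega> \<noteq> {}" and h: "h ` \<Omega> \<subseteq> span B"
    and \<delta>: "0 \<le> \<delta>" "\<delta> \<le> 1"
    and s: "real ((3 * (s + d + 1) ^ d) ^ 2 ^ d) * (1 - \<delta>) ^ (s - 2 ^ d * d) < 1"
  shows "\<exists>G\<subseteq>span B. finite G \<and> card G \<le> 3 * (s + d + 1) ^ d \<and> (\<forall>y\<in>G. - y \<in> G) \<and>
    (\<forall>x\<in>span B. x \<noteq> 0 \<longrightarrow> (\<exists>ys. length ys = 2 ^ d \<and> set ys \<subseteq> G \<and> in_open_cone ys x \<and>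
      real (card {\<omega>\<in>\<Omega>. crosses (h \<omega>) (set ys)}) \<le> \<delta> * card \<Omega>))"
proof -
  define I where "I = (Inl ` {..<s} \<union> Inr ` insert 0 B :: (nat + 'a) set)"
  define gc where "gc = {xs. set xs \<subseteq> I \<and> length xs = d} \<times> {-1, 0, 1::real}"
  define C where "C = {\<kappa>. set \<kappa> \<subseteq> gc \<and> length \<kappa> = 2 ^ d}"
  \<comment> \<open>The sample positions that a candidate reads: at most \<open>d\<close> for each
    of its 2 ^ d generators.\<close>
  define dep where "dep = (\<lambda>\<kappa> :: ((nat + 'a) list \<times> real) list. {i. Inl i \<in> set (concat (map fst \<kappa>))})"
  define X where "X = (\<lambda>\<kappa> f. {\<omega>. crosses (h \<omega>) (generator (span B) (h \<circ> f) ` set \<kappa>)})"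
  have finI: "finite I" using B by (simp add: I_def)
  have cI: "card I \<le> s + d + 1"
  proof -
    have "card I \<le> card (Inl ` {..<s} :: (nat + 'a) set) + card (Inr ` insert 0 B :: (nat + 'a) set)"
      unfolding I_def by (rule card_Un_le)
    also have "card (Inl ` {..<s} :: (nat + 'a) set) = s" by (simp add: card_image)
    also have "card (Inr ` insert 0 B :: (nat + 'a) set) = card (insert 0 B)" by (rule card_image) (rule inj_Inr)
    finally have "card I \<le> s + card (insert 0 B)" .
    also have "\<dots> \<le> s + d + 1" using B by (simp add: card_insert_if d_def)
    finally show ?thesis .
  qed
  have fin_gc: "finite gc" using finI by (simp add: gc_def finite_lists_length_eq)
  \<comment> \<open>\<open>s + d + 1\<close> accounts for the sampled functionals, the basis and the
    zero vector; 3 for the scalars.\<close>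
  have card_gc: "card gc \<le> 3 * (s + d + 1) ^ d"
    using finI power_mono[OF cI, of d] by (simp add: gc_def card_cartesian_product card_lists_length_eq)
  have finC: "finite C" using fin_gc by (simp add: C_def finite_lists_length_eq)
  have cardC: "card C \<le> (3 * (s + d + 1) ^ d) ^ 2 ^ d"
    unfolding C_def card_lists_length_eq[OF fin_gc] by (rule power_mono[OF card_gc]) simp
  have few: "real (card C) * (1 - \<delta>) ^ (s - 2 ^ d * d) < 1"
  proof -
    have "real (card C) * (1 - \<delta>) ^ (s - 2 ^ d * d)
      \<le> real ((3 * (s + d + 1) ^ d) ^ 2 ^ d) * (1 - \<delta>) ^ (s - 2 ^ d * d)"
      using cardC \<delta> by (intro mult_right_mono) (simp_all only: of_nat_le_iff zero_le_power diff_ge_0_iff_ge)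
    then show ?thesis using s by linarith
  qed
  have dep1: "dep \<kappa> \<subseteq> {..<s}" if "\<kappa> \<in> C" for \<kappa>
    using that by (fastforce simp: dep_def C_def gc_def I_def)
  have dep2: "card (dep \<kappa>) \<le> 2 ^ d * d" if "\<kappa> \<in> C" for \<kappa>
  proof -
    have "card (dep \<kappa>) = card (Inl ` dep \<kappa> :: (nat + 'a) set)" by (simp add: card_image)
    also have "\<dots> \<le> card (set (concat (map fst \<kappa>)))" by (intro card_mono) (auto simp: dep_def)
    also have "\<dots> \<le> length (concat (map fst \<kappa>))" by (rule card_length)
    also have "\<dots> = sum_list (map (length \<circ> fst) \<kappa>)" by (simp add: length_concat)
    also have "\<dots> = sum_list (map (\<lambda>_. d) \<kappa>)"
      using that by (intro arg_cong[of _ _ sum_list] map_cong) (auto simp: C_def gc_def)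
    also have "\<dots> = 2 ^ d * d" using that by (simp add: C_def sum_list_triv)
    finally show ?thesis .
  qed
  have X_dep: "\<forall>f g. (\<forall>i\<in>dep \<kappa>. f i = g i) \<longrightarrow> X \<kappa> f = X \<kappa> g" if "\<kappa> \<in> C" for \<kappa>
  proof (intro allI impI)
    fix f g :: "nat \<Rightarrow> 'w" assume eq: "\<forall>i\<in>dep \<kappa>. f i = g i"
    have "generator (span B) (h \<circ> f) k = generator (span B) (h \<circ> g) k" if "k \<in> set \<kappa>" for k
    proof -
      have "sampled (h \<circ> f) j = sampled (h \<circ> g) j" if "j \<in> set (fst k)" for j
      proof (cases j)
        case (Inl i)
        then have "i \<in> dep \<kappa>" using that \<open>k \<in> set \<kappa>\<close> by (auto simp: dep_def)
        then show ?thesis using Inl eq by (simp add: sampled_def)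
      qed (simp add: sampled_def)
      then have "sampled (h \<circ> f) ` set (fst k) = sampled (h \<circ> g) ` set (fst k)" by (intro image_cong) auto
      then show ?thesis by (simp only: generator_def)
    qed
    then have "generator (span B) (h \<circ> f) ` set \<kappa> = generator (span B) (h \<circ> g) ` set \<kappa>"
      by (intro image_cong) auto
    then show "X \<kappa> f = X \<kappa> g" by (simp only: X_def)
  qed
  obtain f where f: "f \<in> {..<s} \<rightarrow> \<Omega>"
    "\<forall>\<kappa>\<in>C. (\<forall>i<s. f i \<notin> X \<kappa> f) \<longrightarrow> real (card (\<Omega> \<inter> X \<kappa> f)) \<le> \<delta> * card \<Omega>"
    using ex_hitting_sample[where C = C and X = X, OF \<Omega> finC \<delta> dep1 dep2 X_dep few] by blast
  define W where "W = sampled (h \<circ> f) ` I"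
  let ?gen = "generator (span B) (h \<circ> f)"
  define G where "G = ?gen ` gc"
  have hf: "h (f i) \<in> W" if "i < s" for i
    using that by (auto simp: W_def I_def sampled_def image_iff intro!: bexI[of _ "Inl i"])
  have BW: "b \<in> W" if "b \<in> B" for b
    using that by (auto simp: W_def I_def sampled_def image_iff intro!: bexI[of _ "Inr b"])
  have W: "finite W" "W \<subseteq> span B"
    using finI f(1) h by (auto simp: W_def I_def sampled_def span_base span_0 image_subset_iff Pi_iff)
  have pointed: "\<forall>x\<in>span B. (\<forall>w\<in>W. w \<bullet> x = 0) \<longrightarrow> x = 0"
  proof (intro ballI impI)
    fix x assume x: "x \<in> span B" "\<forall>w\<in>W. w \<bullet> x = 0"
    have "z \<bullet> x = 0" if "z \<in> span B" for z
      using that by (induction rule: span_induct) (use x BW in \<open>auto simp: subspace_def inner_simps\<close>)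
    then show "x = 0" using x(1) inner_eq_zero_iff by blast
  qed
  have cells: "\<exists>ys. length ys = 2 ^ d \<and> set ys \<subseteq> G \<and> in_open_cone ys x \<and>
      real (card {\<omega>\<in>\<Omega>. crosses (h \<omega>) (set ys)}) \<le> \<delta> * card \<Omega>"
    if x: "x \<in> span B" "x \<noteq> 0" for x
  proof -
    obtain us where us: "length us \<le> 2 ^ d" "x = sum_list us"
      "\<forall>y\<in>set us. extreme_ray W (span B) y \<and> sign_compatible W x y"
      using decompose_into_rays[OF B W pointed x] unfolding d_def by blast
    have "\<exists>k\<in>gc. \<exists>a>0. u = a *\<^sub>R ?gen k" if u: "u \<in> set us" for u
    proof -
      obtain xs c where "set xs \<subseteq> I" "length xs = d" "c \<noteq> 0" "u = \<bar>c\<bar> *\<^sub>R ?gen (xs, sgn c)"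
        using extreme_ray_eq_generator[of B I "h \<circ> f" u] B finI W u us(3) unfolding W_def d_def
        by (auto simp: I_def)
      then show ?thesis
        by (intro bexI[of _ "(xs, sgn c)"] exI[of _ "\<bar>c\<bar>"]) (auto simp: gc_def sgn_if)
    qed
    then have "\<forall>u\<in>set us. \<exists>k. k \<in> gc \<and> (\<exists>a>0. u = a *\<^sub>R ?gen k)" by blast
    then obtain k where k: "\<And>u. u \<in> set us \<Longrightarrow> k u \<in> gc" "\<And>u. u \<in> set us \<Longrightarrow> \<exists>a>0. u = a *\<^sub>R ?gen (k u)"
      by metis
    \<comment> \<open>The decomposition may have fewer than 2 ^ d rays. Zero generators fill the
      list without changing the sum or the crossings.\<close>
    define n where "n = 2 ^ d - length us"
    define null where "null = (replicate d (Inr (0::'a)) :: (nat + 'a) list, 0::real)"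
    have null: "null \<in> gc" by (auto simp: null_def gc_def I_def)
    have gen_null: "?gen null = 0" by (simp add: null_def generator_def)
    define \<kappa> where "\<kappa> = map k us @ replicate n null"
    have \<kappa>: "\<kappa> \<in> C" using k(1) null us(1) by (auto simp: C_def \<kappa>_def n_def)
    define ys where "ys = map ?gen \<kappa>"
    have "in_open_cone ys x"
      unfolding in_open_cone_def
    proof (intro exI conjI)
      have "sum_list (replicate n (0::'a)) = 0" for n by (induction n) auto
      then show "x = sum_list (us @ replicate n 0)" using us(2) by simp
      have "list_all2 (\<lambda>u y. \<exists>a>0. u = a *\<^sub>R y) us (map ?gen (map k us))"
        using k(2) by (simp add: list_all2_conv_all_nth)
      moreover have "list_all2 (\<lambda>u y. \<exists>a>0. u = a *\<^sub>R y) (replicate n 0) (map ?gen (replicate n null))"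
        by (auto simp: list_all2_conv_all_nth gen_null intro!: exI[of _ 1])
      ultimately show "list_all2 (\<lambda>u y. \<exists>a>0. u = a *\<^sub>R y) (us @ replicate n 0) ys"
        unfolding ys_def \<kappa>_def map_append by (rule list_all2_appendI)
    qed
    moreover have "\<forall>i<s. f i \<notin> X \<kappa> f"
    proof (intro allI impI)
      fix i assume "i < s"
      from hf[OF this] have hW: "h (f i) \<in> W" .
      have sgn_gen: "(h (f i) \<bullet> x \<ge> 0 \<longrightarrow> h (f i) \<bullet> ?gen j \<ge> 0) \<and> (h (f i) \<bullet> x \<le> 0 \<longrightarrow> h (f i) \<bullet> ?gen j \<le> 0)"
        if "j \<in> set \<kappa>" for j
      proof -
        have "j = null \<or> (\<exists>u\<in>set us. j = k u)" using that by (auto simp: \<kappa>_def)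
        then show ?thesis
        proof
          assume "j = null" then show ?thesis by (simp add: gen_null)
        next
          assume "\<exists>u\<in>set us. j = k u"
          then obtain u where u: "u \<in> set us" "j = k u" by blast
          obtain a where a: "a > 0" "u = a *\<^sub>R ?gen j" using k(2)[OF u(1)] u(2) by blast
          have "(h (f i) \<bullet> x \<ge> 0 \<longrightarrow> h (f i) \<bullet> u \<ge> 0) \<and> (h (f i) \<bullet> x \<le> 0 \<longrightarrow> h (f i) \<bullet> u \<le> 0)"
            using us(3) u(1) hW by (simp add: sign_compatible_def)
          moreover have "h (f i) \<bullet> u = a * (h (f i) \<bullet> ?gen j)" using a(2) by (metis inner_scaleR_right)
          ultimately show ?thesis using a(1) by (simp add: zero_le_mult_iff mult_le_0_iff)
        qed
      qed
      show "f i \<notin> X \<kappa> f"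
      proof
        assume "f i \<in> X \<kappa> f"
        then obtain j j' where "j \<in> set \<kappa>" "h (f i) \<bullet> ?gen j > 0" "j' \<in> set \<kappa>" "h (f i) \<bullet> ?gen j' < 0"
          by (auto simp: X_def crosses_def)
        then show False using sgn_gen[of j] sgn_gen[of j'] by linarith
      qed
    qed
    then have "real (card (\<Omega> \<inter> X \<kappa> f)) \<le> \<delta> * card \<Omega>" using f(2) \<kappa> by blast
    moreover have "\<Omega> \<inter> X \<kappa> f = {\<omega>\<in>\<Omega>. crosses (h \<omega>) (set ys)}" by (auto simp: X_def ys_def)
    moreover have "length ys = 2 ^ d" "set ys \<subseteq> G" using \<kappa> by (auto simp: ys_def C_def G_def)
    ultimately show ?thesis by metis
  qed
  have "card G \<le> 3 * (s + d + 1) ^ d"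
    using card_image_le[OF fin_gc, of ?gen] card_gc by (simp add: G_def)
  moreover have "- y \<in> G" if y: "y \<in> G" for y
  proof -
    obtain xs \<sigma> where xs: "(xs, \<sigma>) \<in> gc" "y = ?gen (xs, \<sigma>)" using y by (auto simp: G_def)
    then have "(xs, - \<sigma>) \<in> gc" "- y = ?gen (xs, - \<sigma>)" by (auto simp: gc_def generator_def)
    then show ?thesis unfolding G_def by (rule rev_image_eqI)
  qed
  moreover have "G \<subseteq> span B" by (auto simp: G_def generator_def intro!: span_scale ray_of_in)
  moreover have "finite G" using fin_gc by (simp add: G_def)
  ultimately show ?thesis using cells by (intro exI[of _ G]) auto
qed

section \<open>Sign patterns and labels\<close>

text \<open>
  If a pattern on \<open>I\<close> extends to the new index in both ways, then by convexity it also occurs on the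
  kernel of the new functional, where the dimension is smaller.
\<close>

lemma card_sign_patterns:
  fixes h :: "'i \<Rightarrow> 'a::real_inner"
  assumes "finite I"
  shows "subspace U \<Longrightarrow> (\<And>J. J \<subseteq> U \<Longrightarrow> finite J \<Longrightarrow> independent J \<Longrightarrow> card J \<le> k) \<Longrightarrow>
    card ((\<lambda>x. {i\<in>I. 0 \<le> h i \<bullet> x}) ` U) \<le> (card I + 1) ^ k"
  using assms
proof (induction I arbitrary: U k rule: finite_induct)
  case empty
  have "(\<lambda>x. {i\<in>{}. 0 \<le> h i \<bullet> x}) ` U \<subseteq> {{}}" by auto
  from card_mono[OF _ this] show ?case by simp
next
  case (insert i I)
  define pat where "pat = (\<lambda>J x. {i\<in>J. 0 \<le> h i \<bullet> x})"
  let ?P' = "pat (insert i I) ` U"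
  have fin: "finite (pat J ` V)" if "finite J" for J V
    by (rule finite_subset[of _ "Pow J"]) (use that in \<open>auto simp: pat_def\<close>)
  have IH: "card (pat I ` U) \<le> (card I + 1) ^ k" using insert.IH[OF insert.prems] by (simp add: pat_def)
  show ?case
  proof (cases "\<forall>u\<in>U. h i \<bullet> u = 0")
    case True
    have "?P' = insert i ` (pat I ` U)" unfolding image_image
      by (intro image_cong) (use True in \<open>auto simp: pat_def\<close>)
    then have "card ?P' \<le> (card I + 1) ^ k"
      using card_image_le[OF fin, of I "insert i" U] insert.hyps IH by simp
    also have "\<dots> \<le> (card (insert i I) + 1) ^ k" using insert.hyps by (intro power_mono) auto
    finally show ?thesis by (simp add: pat_def)
  next
    case False
    then obtain u where u: "u \<in> U" "h i \<bullet> u \<noteq> 0" by blast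
    define K where "K = {x\<in>U. h i \<bullet> x = 0}"
    have K: "subspace K" using insert.prems(1) by (auto simp: subspace_def K_def inner_simps)
    \<comment> \<open>\<open>u\<close> lies outside the kernel and can be adjoined to any
      independent subset of \<open>K\<close>, so the dimension bound drops to
      \<open>k - 1\<close>.\<close>
    have ind: "Suc (card J) \<le> k" if J: "J \<subseteq> K" "finite J" "independent J" for J
    proof -
      have "\<forall>v\<in>span J. h i \<bullet> v = 0"
        using span_minimal[OF J(1) K] by (auto simp: K_def)
      then have "u \<notin> span J" using u by blast
      then have "independent (insert u J)" "u \<notin> J"
        using J(3) by (auto simp: independent_insert span_base)
      then show ?thesis using insert.prems(2)[of "insert u J"] J u by (auto simp: K_def)
    qed
    have k: "k = Suc (k - 1)" using ind[of "{}"] by (simp add: independent_empty)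
    have "card J \<le> k - 1" if "J \<subseteq> K" "finite J" "independent J" for J using ind[OF that] by simp
    from insert.IH[OF K this] have IHK: "card (pat I ` K) \<le> (card I + 1) ^ (k - 1)" by (simp add: pat_def)
    define A0 where "A0 = {Q\<in>?P'. i \<notin> Q}"
    define A1 where "A1 = {Q\<in>?P'. i \<in> Q}"
    \<comment> \<open>\<open>A0 \<union> R1\<close> consists of the patterns restricted to
      \<open>I\<close>, and \<open>A0 \<inter> R1\<close> of those that extend to \<open>i\<close>
      in both ways.\<close>
    define R1 where "R1 = (\<lambda>Q. Q - {i}) ` A1"
    have finA: "finite A0" "finite A1" using fin[of "insert i I" U] insert.hyps by (auto simp: A0_def A1_def)
    have "card A1 = card R1" unfolding R1_def
      by (rule card_image[symmetric]) (auto simp: inj_on_def A1_def)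
    moreover have "?P' = A0 \<union> A1" "A0 \<inter> A1 = {}" by (auto simp: A0_def A1_def)
    ultimately have "card ?P' = card A0 + card R1" using finA by (simp add: card_Un_disjoint)
    also have "\<dots> = card (A0 \<union> R1) + card (A0 \<inter> R1)"
      using finA by (intro card_Un_Int) (auto simp: R1_def)
    also have "card (A0 \<union> R1) \<le> card (pat I ` U)"
    proof (intro card_mono fin insert.hyps subsetI)
      fix Q assume "Q \<in> A0 \<union> R1"
      then obtain x where "x \<in> U" "Q = pat (insert i I) x - {i}" by (auto simp: A0_def A1_def R1_def)
      moreover have "pat (insert i I) x - {i} = pat I x" for x using insert.hyps by (auto simp: pat_def)
      ultimately show "Q \<in> pat I ` U" by simp
    qed
    also have "card (A0 \<inter> R1) \<le> card (pat I ` K)"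
    proof (intro card_mono fin insert.hyps subsetI)
      fix Q assume "Q \<in> A0 \<inter> R1"
      then obtain x x' where x: "x \<in> U" "Q = pat (insert i I) x" "i \<notin> Q"
        and x': "x' \<in> U" "Q = pat (insert i I) x' - {i}" "i \<in> pat (insert i I) x'"
        by (auto simp: A0_def A1_def R1_def)
      \<comment> \<open>The weights \<open>a\<close> and \<open>b\<close> make \<open>h i\<close>
        vanish at \<open>y\<close>. Strict positivity of \<open>b\<close> lets negativity at
        \<open>x'\<close> survive even when \<open>a = 0\<close>.\<close>
      define a where "a = h i \<bullet> x'"
      define b where "b = - (h i \<bullet> x)"
      have ab: "a \<ge> 0" "b > 0" using x x' by (auto simp: a_def b_def pat_def)
      define y where "y = a *\<^sub>R x + b *\<^sub>R x'"
      have "y \<in> K" using insert.prems(1) x(1) x'(1)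
        by (auto simp: K_def y_def a_def b_def inner_simps subspace_add subspace_diff subspace_scale)
      moreover have "pat I y = Q"
      proof -
        have "0 \<le> h j \<bullet> y \<longleftrightarrow> j \<in> Q" if "j \<in> I" for j
        proof -
          have ji: "j \<noteq> i" using that insert.hyps by auto
          have 1: "j \<in> Q \<longleftrightarrow> 0 \<le> h j \<bullet> x" using x(2) that by (auto simp: pat_def)
          have 2: "j \<in> Q \<longleftrightarrow> 0 \<le> h j \<bullet> x'" using x'(2) that ji by (auto simp: pat_def)
          have e: "h j \<bullet> y = a * (h j \<bullet> x) + b * (h j \<bullet> x')" by (simp add: y_def inner_simps)
          show ?thesis
          proof (cases "j \<in> Q")
            case True
            then show ?thesis using 1 2 ab e by simp
          next
            case False
            then have "a * (h j \<bullet> x) \<le> 0" "b * (h j \<bullet> x') < 0"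
              using 1 2 ab by (auto simp: mult_le_0_iff mult_less_0_iff)
            then show ?thesis using False e by simp
          qed
        qed
        moreover have "Q \<subseteq> I" using x by (auto simp: pat_def)
        ultimately show ?thesis by (auto simp: pat_def)
      qed
      ultimately show "Q \<in> pat I ` K" by blast
    qed
    finally have "card ?P' \<le> (card I + 1) ^ k + (card I + 1) ^ (k - 1)" using IH IHK by simp
    also have "\<dots> = (card I + 1) ^ (k - 1) * (card I + 2)" by (subst k) simp
    also have "\<dots> \<le> (card I + 2) ^ (k - 1) * (card I + 2)" by (intro mult_right_mono power_mono) auto
    also have "\<dots> = (card (insert i I) + 1) ^ k" using insert.hyps by (subst (2) k) simp
    finally show ?thesis by (simp add: pat_def)
  qed
qed

text \<open>The label of \<open>v\<close> pairs the cone \<open>c v\<close> chosen for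
  \<open>\<phi> v\<close> with the signs \<open>\<tau> v\<close> of the functionals of
  \<open>v\<close> on all rays of \<open>G\<close>. Whether some functional of \<open>v\<close>
  crosses the cone of \<open>u\<close> is visible from \<open>c u\<close> and
  \<open>\<tau> v\<close>, and if none does, so are the signs at \<open>\<phi> u\<close>. The
  hypothesis \<open>adjoint\<close> allows the form to be read as a functional in either argument,
  which is what bounds the number of sign vectors.\<close>

lemma ex_cell_and_sign_labelling:
  fixes B :: "'e::real_inner set" and \<phi> :: "'p \<Rightarrow> 'e" and hl hr :: "'j \<Rightarrow> 'e \<Rightarrow> 'e" and \<delta> :: real
  defines "d \<equiv> card B"
  defines "g \<equiv> \<lambda>s. 3 * (s + d + 1) ^ d"
  assumes B: "finite B" and V: "finite V" "V \<noteq> {}" and J: "finite J" "J \<noteq> {}"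
    and \<phi>: "\<And>v. v \<in> V \<Longrightarrow> \<phi> v \<in> span B" "\<And>v. v \<in> V \<Longrightarrow> \<phi> v \<noteq> 0"
    and hl: "\<And>j y. j \<in> J \<Longrightarrow> hl j y \<in> span B"
    and adjoint: "\<And>j x y. j \<in> J \<Longrightarrow> hl j y \<bullet> x = hr j x \<bullet> y"
    and \<delta>: "0 \<le> \<delta>" "\<delta> \<le> 1"
    and s: "real (g s ^ 2 ^ d) * (1 - \<delta>) ^ (s - 2 ^ d * d) < 1"
  shows "\<exists>(f :: 'p \<Rightarrow> 'e list \<times> ('j \<times> 'e) set) bad.
    card (f ` V) \<le> g s ^ 2 ^ d * (card J * g s + 1) ^ d \<and>
    real (card {(u, v). u \<in> V \<and> v \<in> V \<and> bad (f u) (f v)}) \<le> \<delta> * card J * (real (card V))\<^sup>2 \<and>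
    (\<forall>u\<in>V. \<forall>v\<in>V. \<forall>u'\<in>V. \<forall>v'\<in>V. \<forall>j\<in>J. f u = f u' \<longrightarrow> f v = f v' \<longrightarrow> \<not> bad (f u) (f v) \<longrightarrow>
      (0 \<le> hl j (\<phi> v) \<bullet> \<phi> u \<longleftrightarrow> 0 \<le> hl j (\<phi> v') \<bullet> \<phi> u'))"
proof -
  define \<Omega> where "\<Omega> = V \<times> J"
  define h where "h = (\<lambda>(v, j). hl j (\<phi> v))"
  have \<Omega>: "finite \<Omega>" "\<Omega> \<noteq> {}" using V J by (auto simp: \<Omega>_def)
  have h: "h ` \<Omega> \<subseteq> span B" using hl by (auto simp: h_def \<Omega>_def)
  have "\<exists>G\<subseteq>span B. finite G \<and> card G \<le> g s \<and> (\<forall>y\<in>G. - y \<in> G) \<and>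
    (\<forall>x\<in>span B. x \<noteq> 0 \<longrightarrow> (\<exists>ys. length ys = 2 ^ d \<and> set ys \<subseteq> G \<and> in_open_cone ys x \<and>
      real (card {\<omega>\<in>\<Omega>. crosses (h \<omega>) (set ys)}) \<le> \<delta> * card \<Omega>))"
    unfolding d_def g_def by (rule weak_cutting[OF B \<Omega> h \<delta> s[unfolded g_def d_def]])
  then obtain G where G: "G \<subseteq> span B" "finite G" "card G \<le> g s" "\<forall>y\<in>G. - y \<in> G"
    and cells: "\<forall>x\<in>span B. x \<noteq> 0 \<longrightarrow> (\<exists>ys. length ys = 2 ^ d \<and> set ys \<subseteq> G \<and> in_open_cone ys x \<and>
      real (card {\<omega>\<in>\<Omega>. crosses (h \<omega>) (set ys)}) \<le> \<delta> * card \<Omega>)"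
    by (elim exE conjE) (rule that)
  have "\<forall>v\<in>V. \<exists>ys. length ys = 2 ^ d \<and> set ys \<subseteq> G \<and> in_open_cone ys (\<phi> v) \<and>
      real (card {\<omega>\<in>\<Omega>. crosses (h \<omega>) (set ys)}) \<le> \<delta> * card \<Omega>"
    using cells \<phi> by blast
  from bchoice[OF this] obtain c where c: "\<forall>v\<in>V. length (c v) = 2 ^ d \<and> set (c v) \<subseteq> G \<and>
      in_open_cone (c v) (\<phi> v) \<and> real (card {\<omega>\<in>\<Omega>. crosses (h \<omega>) (set (c v))}) \<le> \<delta> * card \<Omega>"
    by (elim exE) (rule that)
  define \<tau> where "\<tau> = (\<lambda>v. {(j, y) \<in> J \<times> G. 0 \<le> hl j (\<phi> v) \<bullet> y})"
  define f where "f = (\<lambda>v. (c v, \<tau> v))"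
  \<comment> \<open>\<open>\<tau>\<close> records weak signs only:
    \<open>(j, - y) \<notin> T\<close> expresses strict positivity at \<open>y\<close>, which relies
    on \<open>G\<close> being closed under negation.\<close>
  define bad where "bad = (\<lambda>(a, _ :: ('j \<times> 'e) set) (_ :: 'e list, T :: ('j \<times> 'e) set).
    \<exists>j\<in>J. (\<exists>y\<in>set a. (j, - y) \<notin> T) \<and> (\<exists>y\<in>set a. (j, y) \<notin> T))"
  have bad_iff: "bad (f u) (f v) \<longleftrightarrow> (\<exists>j\<in>J. crosses (h (v, j)) (set (c u)))" if "u \<in> V" for u v
  proof -
    have "set (c u) \<subseteq> G" using bspec[OF c that] by (elim conjE)
    then have "(j, y) \<notin> \<tau> v \<longleftrightarrow> h (v, j) \<bullet> y < 0" "(j, - y) \<notin> \<tau> v \<longleftrightarrow> h (v, j) \<bullet> y > 0"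
      if "j \<in> J" "y \<in> set (c u)" for j y
      using that G(4) by (auto simp: \<tau>_def h_def)
    then show ?thesis by (auto simp: bad_def f_def crosses_def)
  qed
  have card_\<tau>: "card (\<tau> ` V) \<le> (card J * g s + 1) ^ d"
  proof -
    \<comment> \<open>By \<open>adjoint\<close>, each \<open>(j, y)\<close> acts on
      \<open>\<phi> v\<close> as the functional \<open>hr j y\<close>, which does not depend on
      \<open>v\<close>. So \<open>\<tau> v\<close> is a sign pattern of
      \<open>card J * card G\<close> functionals in dimension at most \<open>d\<close>.\<close>
    define pat where "pat = (\<lambda>x. {p \<in> J \<times> G. 0 \<le> (case p of (j, y) \<Rightarrow> hr j y) \<bullet> x})"
    have fin: "finite (J \<times> G)" using J G by simp
    have "\<tau> v = pat (\<phi> v)" for v using adjoint by (auto simp: \<tau>_def pat_def)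
    then have sub: "\<tau> ` V \<subseteq> pat ` span B" using \<phi>(1) by auto
    have "finite (pat ` span B)"
      by (rule finite_subset[of _ "Pow (J \<times> G)"]) (use fin in \<open>auto simp: pat_def\<close>)
    then have "card (\<tau> ` V) \<le> card (pat ` span B)" by (rule card_mono[OF _ sub])
    also have "\<dots> \<le> (card (J \<times> G) + 1) ^ d" unfolding pat_def
      by (rule card_sign_patterns[OF fin subspace_span]) (use independent_span_bound[OF B] d_def in blast)
    also have "\<dots> \<le> (card J * g s + 1) ^ d"
      using G(3) by (intro power_mono) (auto simp: card_cartesian_product)
    finally show ?thesis .
  qed
  have "card (f ` V) \<le> g s ^ 2 ^ d * (card J * g s + 1) ^ d"
  proof -
    let ?C = "{ys. set ys \<subseteq> G \<and> length ys = 2 ^ d}"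
    have "f ` V \<subseteq> ?C \<times> \<tau> ` V" using c by (auto simp: f_def)
    then have "card (f ` V) \<le> card (?C \<times> \<tau> ` V)"
      using V finite_lists_length_eq[OF G(2)] by (intro card_mono) auto
    also have "\<dots> = card G ^ 2 ^ d * card (\<tau> ` V)"
      by (simp only: card_cartesian_product card_lists_length_eq[OF G(2)])
    also have "\<dots> \<le> g s ^ 2 ^ d * (card J * g s + 1) ^ d"
      using G(3) card_\<tau> by (intro mult_mono power_mono) auto
    finally show ?thesis .
  qed
  moreover have "real (card {(u, v). u \<in> V \<and> v \<in> V \<and> bad (f u) (f v)}) \<le> \<delta> * card J * (real (card V))\<^sup>2"
  proof -
    have row: "real (card {v\<in>V. bad (f u) (f v)}) \<le> \<delta> * card J * card V" if u: "u \<in> V" for u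
    proof -
      let ?X = "{\<omega>\<in>\<Omega>. crosses (h \<omega>) (set (c u))}"
      \<comment> \<open>Crossings are counted relative to
        \<open>card \<Omega> = card V * card J\<close>; projecting to \<open>V\<close> is the origin
        of the factor \<open>card J\<close>.\<close>
      have "{v\<in>V. bad (f u) (f v)} \<subseteq> fst ` ?X"
      proof
        fix v assume "v \<in> {v\<in>V. bad (f u) (f v)}"
        then obtain j where "j \<in> J" "v \<in> V" "crosses (h (v, j)) (set (c u))" using bad_iff[OF u] by auto
        then show "v \<in> fst ` ?X" by (intro image_eqI[of _ _ "(v, j)"]) (auto simp: \<Omega>_def)
      qed
      then have "card {v\<in>V. bad (f u) (f v)} \<le> card ?X"
        using \<Omega>(1) by (intro surj_card_le) auto
      then have "real (card {v\<in>V. bad (f u) (f v)}) \<le> real (card ?X)" by simp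
      also have "\<dots> \<le> \<delta> * card \<Omega>" using bspec[OF c u] by (elim conjE)
      also have "\<dots> = \<delta> * card J * card V" by (simp add: \<Omega>_def card_cartesian_product)
      finally show ?thesis .
    qed
    have eq: "{(u, v). u \<in> V \<and> v \<in> V \<and> bad (f u) (f v)} = (SIGMA u:V. {v\<in>V. bad (f u) (f v)})" by auto
    have "real (card {(u, v). u \<in> V \<and> v \<in> V \<and> bad (f u) (f v)}) = (\<Sum>u\<in>V. real (card {v\<in>V. bad (f u) (f v)}))"
      unfolding eq using V by simp
    also have "\<dots> \<le> (\<Sum>u\<in>V. \<delta> * card J * card V)" by (intro sum_mono row)
    also have "\<dots> = \<delta> * card J * (real (card V))\<^sup>2" by (simp add: power2_eq_square)
    finally show ?thesis .
  qed
  moreover have "0 \<le> hl j (\<phi> v) \<bullet> \<phi> u \<longleftrightarrow> 0 \<le> hl j (\<phi> v') \<bullet> \<phi> u'"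
    if u: "u \<in> V" "u' \<in> V" "f u = f u'" and v: "v \<in> V" "v' \<in> V" "f v = f v'" and j: "j \<in> J"
      and nb: "\<not> bad (f u) (f v)" for u v u' v' j
  proof -
    have cu: "c u' = c u" "\<tau> v' = \<tau> v" using u(3) v(3) by (auto simp: f_def)
    have sub: "set (c u) \<subseteq> G" using bspec[OF c u(1)] by (elim conjE)
    \<comment> \<open>The right-hand side mentions \<open>c u\<close> and \<open>\<tau> v\<close>
      only, hence is common to all points with these labels.\<close>
    have *: "0 \<le> hl j (\<phi> w) \<bullet> \<phi> x \<longleftrightarrow> (\<forall>y\<in>set (c u). (j, y) \<in> \<tau> v)"
      if "x \<in> V" "w \<in> V" "c x = c u" "\<tau> w = \<tau> v" "\<not> bad (f x) (f w)" for x w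
    proof -
      have "\<not> crosses (hl j (\<phi> w)) (set (c x))" using bad_iff[OF that(1), of w] that(5) j by (auto simp: h_def)
      moreover have "in_open_cone (c x) (\<phi> x)" using bspec[OF c that(1)] by (elim conjE)
      ultimately have "0 \<le> hl j (\<phi> w) \<bullet> \<phi> x \<longleftrightarrow> (\<forall>y\<in>set (c u). 0 \<le> hl j (\<phi> w) \<bullet> y)"
        using not_crosses_nonneg_iff[of "c x" "\<phi> x"] that(3) by metis
      also have "\<dots> \<longleftrightarrow> (\<forall>y\<in>set (c u). (j, y) \<in> \<tau> w)" using sub j by (auto simp: \<tau>_def)
      finally show ?thesis using that(4) by simp
    qed
    show ?thesis using *[of u v] *[of u' v'] u v cu nb by metis
  qed
  ultimately show ?thesis by (intro exI[of _ f] exI[of _ bad]) blast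
qed

section \<open>Linearisation of polynomials\<close>

definition monomials_upto :: "nat \<Rightarrow> ('d::finite \<Rightarrow>\<^sub>0 nat) set" where
  "monomials_upto t = {\<mu>. monom_degree \<mu> \<le> t}"

definition monomial_basis :: "nat \<Rightarrow> (('d::finite \<Rightarrow>\<^sub>0 nat) \<Rightarrow>\<^sub>0 real) set" where
  "monomial_basis t = (\<lambda>\<mu>. Poly_Mapping.single \<mu> 1) ` monomials_upto t"

definition eval_monomial :: "real ^ 'd \<Rightarrow> ('d::finite \<Rightarrow>\<^sub>0 nat) \<Rightarrow> real" where
  "eval_monomial u \<mu> = (\<Prod>i\<in>UNIV. (u $ i) ^ Poly_Mapping.lookup \<mu> i)"

definition veronese :: "nat \<Rightarrow> real ^ 'd \<Rightarrow> ('d::finite \<Rightarrow>\<^sub>0 nat) \<Rightarrow>\<^sub>0 real" where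
  "veronese t u = (\<Sum>\<mu>\<in>monomials_upto t. eval_monomial u \<mu> *\<^sub>R Poly_Mapping.single \<mu> 1)"

definition restrict_left :: "('a + 'b \<Rightarrow>\<^sub>0 nat) \<Rightarrow> 'a \<Rightarrow>\<^sub>0 nat" where
  "restrict_left \<kappa> = Poly_Mapping.map_key Inl \<kappa>"

definition restrict_right :: "('a + 'b \<Rightarrow>\<^sub>0 nat) \<Rightarrow> 'b \<Rightarrow>\<^sub>0 nat" where
  "restrict_right \<kappa> = Poly_Mapping.map_key Inr \<kappa>"

text \<open>The coefficients of \<open>g\<close> define a bilinear form on coefficient vectors; this
  vector represents it once the second argument is fixed to \<open>y\<close>.
  \<open>contract_left\<close> fixes the first argument instead.\<close>

definition contract_right :: "('d + 'd) real_mpoly \<Rightarrow> (('d \<Rightarrow>\<^sub>0 nat) \<Rightarrow>\<^sub>0 real) \<Rightarrow> ('d \<Rightarrow>\<^sub>0 nat) \<Rightarrow>\<^sub>0 real" where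
  "contract_right g y = (\<Sum>\<kappa>\<in>Poly_Mapping.keys g.
     (Poly_Mapping.lookup g \<kappa> * Poly_Mapping.lookup y (restrict_right \<kappa>)) *\<^sub>R Poly_Mapping.single (restrict_left \<kappa>) 1)"

definition contract_left :: "('d + 'd) real_mpoly \<Rightarrow> (('d \<Rightarrow>\<^sub>0 nat) \<Rightarrow>\<^sub>0 real) \<Rightarrow> ('d \<Rightarrow>\<^sub>0 nat) \<Rightarrow>\<^sub>0 real" where
  "contract_left g x = (\<Sum>\<kappa>\<in>Poly_Mapping.keys g.
     (Poly_Mapping.lookup g \<kappa> * Poly_Mapping.lookup x (restrict_left \<kappa>)) *\<^sub>R Poly_Mapping.single (restrict_right \<kappa>) 1)"

lemma lookup_restrict [simp]:
  "Poly_Mapping.lookup (restrict_left \<kappa>) i = Poly_Mapping.lookup \<kappa> (Inl i)"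
  "Poly_Mapping.lookup (restrict_right \<kappa>) j = Poly_Mapping.lookup \<kappa> (Inr j)"
  by (simp_all add: restrict_left_def restrict_right_def map_key.rep_eq)

lemma monom_degree_conv_UNIV:
  "monom_degree (\<mu> :: 'd::finite \<Rightarrow>\<^sub>0 nat) = (\<Sum>i\<in>UNIV. Poly_Mapping.lookup \<mu> i)"
  unfolding monom_degree_def by (intro sum.mono_neutral_left) (auto simp: in_keys_iff)

lemma finite_monomials_upto: "finite (monomials_upto t :: ('d::finite \<Rightarrow>\<^sub>0 nat) set)"
proof (rule finite_imageD)
  have "Poly_Mapping.lookup \<mu> i \<le> t" if "\<mu> \<in> monomials_upto t" for \<mu> :: "'d \<Rightarrow>\<^sub>0 nat" and i
  proof -
    have "Poly_Mapping.lookup \<mu> i \<le> monom_degree \<mu>"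
      unfolding monom_degree_conv_UNIV by (rule member_le_sum) auto
    then show ?thesis using that by (simp add: monomials_upto_def)
  qed
  then have "Poly_Mapping.lookup ` (monomials_upto t :: ('d \<Rightarrow>\<^sub>0 nat) set) \<subseteq> (UNIV \<rightarrow>\<^sub>E {..t})"
    by (intro image_subsetI PiE_I) auto
  then show "finite (Poly_Mapping.lookup ` (monomials_upto t :: ('d \<Rightarrow>\<^sub>0 nat) set))"
    by (rule finite_subset) (simp add: finite_PiE)
  show "inj_on Poly_Mapping.lookup (monomials_upto t :: ('d \<Rightarrow>\<^sub>0 nat) set)"
    by (rule inj_onI) (simp add: lookup_inject)
qed

lemma finite_monomial_basis: "finite (monomial_basis t :: (('d::finite \<Rightarrow>\<^sub>0 nat) \<Rightarrow>\<^sub>0 real) set)"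
  by (simp add: monomial_basis_def finite_monomials_upto)

lemma single_in_span: "\<mu> \<in> monomials_upto t \<Longrightarrow> Poly_Mapping.single \<mu> 1 \<in> span (monomial_basis t)"
  by (intro span_base) (simp add: monomial_basis_def)

lemma veronese_in_span: "veronese t u \<in> span (monomial_basis t)"
  unfolding veronese_def by (intro span_sum span_scale single_in_span)

lemma lookup_veronese:
  "\<mu> \<in> monomials_upto t \<Longrightarrow> Poly_Mapping.lookup (veronese t u) \<mu> = eval_monomial u \<mu>"
  by (simp add: veronese_def lookup_sum lookup_single when_def finite_monomials_upto mult_delta_right)

text \<open>The constant monomial contributes the coordinate 1. Cones are available for nonzero
  vectors only.\<close>

lemma veronese_nonzero: "veronese t u \<noteq> 0"
proof
  assume "veronese t u = 0"
  moreover have "0 \<in> monomials_upto t" by (simp add: monomials_upto_def monom_degree_conv_UNIV)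
  ultimately show False using lookup_veronese[of 0 t u] by (simp add: eval_monomial_def)
qed

lemma inner_contract_right: "contract_right g y \<bullet> x =
    (\<Sum>\<kappa>\<in>Poly_Mapping.keys g. Poly_Mapping.lookup g \<kappa> *
      (Poly_Mapping.lookup x (restrict_left \<kappa>) * Poly_Mapping.lookup y (restrict_right \<kappa>)))"
  by (simp add: contract_right_def inner_sum_left mult_ac)

lemma contract_adjoint: "contract_right g y \<bullet> x = contract_left g x \<bullet> y"
  unfolding inner_contract_right by (simp add: contract_left_def inner_sum_left mult_ac)

text \<open>The degree of \<open>\<kappa>\<close> is the sum of the degrees of its two halves, so
  one bound \<open>t\<close> serves both.\<close>

lemma restrict_in_monomials_upto:
  fixes g :: "('d::finite + 'd) real_mpoly"
  assumes "\<kappa> \<in> Poly_Mapping.keys g" "total_degree g \<le> t"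
  shows "restrict_left \<kappa> \<in> monomials_upto t" "restrict_right \<kappa> \<in> monomials_upto t"
proof -
  have "monom_degree \<kappa> \<le> total_degree g"
    unfolding total_degree_def using assms(1) by (intro Max_ge) auto
  moreover have "monom_degree \<kappa> = monom_degree (restrict_left \<kappa>) + monom_degree (restrict_right \<kappa>)"
    unfolding monom_degree_conv_UNIV
    using sum.Plus[of UNIV UNIV "Poly_Mapping.lookup \<kappa>"] by (simp add: o_def)
  ultimately show "restrict_left \<kappa> \<in> monomials_upto t" "restrict_right \<kappa> \<in> monomials_upto t"
    using assms(2) by (auto simp: monomials_upto_def)
qed

lemma contract_right_in_span:
  "total_degree g \<le> t \<Longrightarrow> contract_right g y \<in> span (monomial_basis t)"
  unfolding contract_right_def
  by (intro span_sum span_scale single_in_span restrict_in_monomials_upto)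

text \<open>Taken over all of \<open>'d + 'd\<close>, where absent variables contribute power 0, the
  product splits into a monomial in \<open>u\<close> and a monomial in \<open>v\<close>.\<close>

lemma eval_pair_eq_inner:
  assumes "total_degree g \<le> t"
  shows "eval_pair g u v = contract_right g (veronese t v) \<bullet> veronese t u"
proof -
  have "(\<Prod>x\<in>Poly_Mapping.keys \<kappa>. case_sum (\<lambda>i. u $ i) (\<lambda>i. v $ i) x ^ Poly_Mapping.lookup \<kappa> x) =
      eval_monomial u (restrict_left \<kappa>) * eval_monomial v (restrict_right \<kappa>)" for \<kappa>
  proof -
    have "(\<Prod>x\<in>Poly_Mapping.keys \<kappa>. case_sum (\<lambda>i. u $ i) (\<lambda>i. v $ i) x ^ Poly_Mapping.lookup \<kappa> x) =
        (\<Prod>x\<in>UNIV. case_sum (\<lambda>i. u $ i) (\<lambda>i. v $ i) x ^ Poly_Mapping.lookup \<kappa> x)"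
      by (intro prod.mono_neutral_left) (auto simp: in_keys_iff)
    also have "\<dots> = eval_monomial u (restrict_left \<kappa>) * eval_monomial v (restrict_right \<kappa>)"
      using prod.Plus[of UNIV UNIV "\<lambda>x. case_sum (\<lambda>i. u $ i) (\<lambda>i. v $ i) x ^ Poly_Mapping.lookup \<kappa> x"]
      by (simp add: eval_monomial_def o_def)
    finally show ?thesis .
  qed
  then show ?thesis
    unfolding eval_pair_def eval_mpoly_def inner_contract_right
    by (intro sum.cong refl) (simp add: lookup_veronese restrict_in_monomials_upto[OF _ assms])
qed

section \<open>Equitable partitions\<close>

text \<open>With \<open>V\<close> sorted by label, a block that is not constant begins with a
  smaller label than it ends with. The last labels of such blocks therefore increase strictly from
  block to block, so there are at most as many of them as labels.\<close>

lemma ex_equitable_partition_by_label: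
  fixes f :: "'a \<Rightarrow> 'b"
  assumes V: "finite V" and K: "K \<ge> 1"
  shows "\<exists>P. equitable_partition V K P \<and> (\<forall>i\<in>{1..K}. card (P i) \<ge> card V div K) \<and>
    card {i\<in>{1..K}. \<not> (\<exists>l. \<forall>v\<in>P i. f v = l)} \<le> card (f ` V)"
proof -
  define n where "n = card V"
  \<comment> \<open>Labels carry no order; any injection into the naturals serves for
    sorting.\<close>
  obtain r :: "'b \<Rightarrow> nat" where r: "inj_on r (f ` V)"
    using finite_imp_inj_to_nat_seg V by (metis finite_imageI)
  obtain vs0 where vs0: "set vs0 = V" "distinct vs0" using finite_distinct_list[OF V] by blast
  define vs where "vs = sort_key (r \<circ> f) vs0"
  have vs: "set vs = V" "distinct vs" "length vs = n" "sorted (map (r \<circ> f) vs)"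
    using vs0 distinct_card[OF vs0(2)] by (auto simp: vs_def n_def)
  have mono: "r (f (vs ! p)) \<le> r (f (vs ! q))" if "p \<le> q" "q < n" for p q
    using sorted_nth_mono[OF vs(4), of p q] that vs(3) by simp
  \<comment> \<open>Cut points at i n / K rounded down: consecutive ones differ by
    \<open>n div K\<close> or by one more.\<close>
  define a where "a = (\<lambda>i. i * n div K)"
  define P where "P = (\<lambda>i. (!) vs ` {a (i - 1)..<a i})"
  have a0: "a 0 = 0" and aK: "a K = n" using K by (auto simp: a_def)
  have a_mono: "a i \<le> a j" if "i \<le> j" for i j
    using that by (auto simp: a_def intro!: div_le_mono)
  have a_le: "a i \<le> n" if "i \<le> K" for i using a_mono[OF that] aK by simp
  have step: "a (i - 1) + n div K \<le> a i \<and> a i \<le> a (i - 1) + n div K + 1" if "i \<ge> 1" for i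
  proof -
    have i: "i * n = (i - 1) * n + n" using that by (cases i) auto
    have "a i = a (i - 1) + n div K + ((i - 1) * n mod K + n mod K) div K"
      unfolding a_def i by (rule div_add1_eq)
    moreover have "(i - 1) * n mod K + n mod K < 2 * K"
      using K mod_less_divisor[of K "(i - 1) * n"] mod_less_divisor[of K n] by linarith
    then have "((i - 1) * n mod K + n mod K) div K < 2"
      using K by (simp add: div_less_iff_less_mult)
    ultimately show ?thesis by linarith
  qed
  have inj: "inj_on ((!) vs) {..<n}" using vs(2,3) by (auto simp: inj_on_nth)
  have cardP: "card (P i) = a i - a (i - 1)" if "i \<in> {1..K}" for i
    unfolding P_def using a_le[of i] that inj
    by (subst card_image) (auto intro: inj_on_subset)
  have size: "card V div K \<le> card (P i)" "card (P i) \<le> card V div K + 1" if "i \<in> {1..K}" for i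
    using cardP[OF that] step[of i] that by (auto simp: n_def)
  have cover: "V = (\<Union>i\<in>{1..K}. P i)"
  proof
    show "V \<subseteq> (\<Union>i\<in>{1..K}. P i)"
    proof
      fix v assume "v \<in> V"
      then obtain p where p: "p < n" "v = vs ! p" using vs(1,3) by (metis in_set_conv_nth)
      \<comment> \<open>The block of position \<open>p\<close> ends at the first cut beyond
        \<open>p\<close>.\<close>
      define i where "i = (LEAST i. p < a i)"
      have i: "p < a i" "i \<le> K" unfolding i_def using p(1) aK by (auto intro: LeastI Least_le)
      then have "i \<noteq> 0" using a0 by (metis not_less_zero)
      then have "\<not> p < a (i - 1)" unfolding i_def by (intro not_less_Least) simp
      then show "v \<in> (\<Union>i\<in>{1..K}. P i)" using i p(2) \<open>i \<noteq> 0\<close>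
        by (intro UN_I[of i]) (auto simp: P_def)
    qed
    show "(\<Union>i\<in>{1..K}. P i) \<subseteq> V"
    proof (intro UN_least)
      fix i assume "i \<in> {1..K}"
      then have "a i \<le> length vs" using a_le vs(3) by simp
      then show "P i \<subseteq> V" using vs(1) by (auto simp: P_def)
    qed
  qed
  have disj: "P i \<inter> P j = {}" if "i \<in> {1..K}" "j \<in> {1..K}" "i < j" for i j
  proof -
    have "i \<le> j - 1" using that(3) by linarith
    then have "a i \<le> a (j - 1)" by (rule a_mono)
    then have "{a (i - 1)..<a i} \<inter> {a (j - 1)..<a j} = {}" by auto
    moreover have "{a (i - 1)..<a i} \<subseteq> {..<n}" "{a (j - 1)..<a j} \<subseteq> {..<n}"
      using a_le[of i] a_le[of j] that by auto
    then have "P i \<inter> P j = (!) vs ` ({a (i - 1)..<a i} \<inter> {a (j - 1)..<a j})"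
      unfolding P_def by (rule inj_on_image_Int[OF inj, symmetric])
    ultimately show ?thesis by (simp only: image_empty)
  qed
  have "disjoint_family_on P {1..K}"
    unfolding disjoint_family_on_def
  proof (intro ballI impI)
    fix i j assume ij: "i \<in> {1..K}" "j \<in> {1..K}" "i \<noteq> j"
    then consider "i < j" | "j < i" by linarith
    then show "P i \<inter> P j = {}" using disj[of i j] disj[of j i] ij by cases auto
  qed
  moreover have "card (P i) \<le> card (P j) + 1" if "i \<in> {1..K}" "j \<in> {1..K}" for i j
    using size(2)[OF that(1)] size(1)[OF that(2)] by linarith
  ultimately have eq: "equitable_partition V K P"
    using cover by (auto simp: equitable_partition_def)
  define N where "N = {i\<in>{1..K}. \<not> (\<exists>l. \<forall>v\<in>P i. f v = l)}"
  \<comment> \<open>The label at the last position of block \<open>i\<close>. For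
    \<open>i \<in> N\<close> the block is nonempty, so \<open>a i - 1\<close> does lie in
    it.\<close>
  define g where "g = (\<lambda>i. f (vs ! (a i - 1)))"
  have N: "i \<in> {1..K}" "a (i - 1) < a i" "r (f (vs ! a (i - 1))) < r (g i)" "g i \<in> f ` V" if "i \<in> N" for i
  proof -
    show i: "i \<in> {1..K}" using that by (simp add: N_def)
    have ai: "a i \<le> n" using a_le i by simp
    have "P i \<noteq> {}" using that by (auto simp: N_def)
    then show lt: "a (i - 1) < a i" by (auto simp: P_def)
    show gi: "g i \<in> f ` V" unfolding g_def using lt ai vs(1,3) by (intro imageI) (auto simp flip: vs(1))
    show "r (f (vs ! a (i - 1))) < r (g i)"
    proof (rule ccontr)
      assume "\<not> ?thesis"
      then have le: "r (g i) \<le> r (f (vs ! a (i - 1)))" by simp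
      have "f v = g i" if "v \<in> P i" for v
      proof -
        obtain p where p: "v = vs ! p" "a (i - 1) \<le> p" "p < a i" using \<open>v \<in> P i\<close> by (auto simp: P_def)
        have "r (f v) \<le> r (g i)" unfolding g_def p(1) using p ai by (intro mono) auto
        moreover have "r (f (vs ! a (i - 1))) \<le> r (f v)" unfolding p(1) using p ai by (intro mono) auto
        ultimately have "r (f v) = r (g i)" using le by linarith
        moreover have "v \<in> V" using \<open>v \<in> P i\<close> cover i by blast
        ultimately show ?thesis using r gi by (auto dest: inj_onD)
      qed
      then show False using that by (auto simp: N_def)
    qed
  qed
  have g_less: "r (g i) < r (g j)" if "i \<in> N" "j \<in> N" "i < j" for i j
  proof -
    have "i \<le> j - 1" using that(3) by linarith
    then have "a i \<le> a (j - 1)" by (rule a_mono)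
    then have "r (g i) \<le> r (f (vs ! a (j - 1)))" unfolding g_def
      using N(2)[OF that(2)] a_le[of j] N(1)[OF that(2)] by (intro mono) auto
    then show ?thesis using N(3)[OF that(2)] by linarith
  qed
  have "inj_on g N"
  proof (rule inj_onI)
    fix i j assume "i \<in> N" "j \<in> N" "g i = g j"
    then show "i = j" using g_less[of i j] g_less[of j i] by (cases i j rule: linorder_cases) auto
  qed
  then have "card N \<le> card (f ` V)" using N(4) V by (intro card_inj_on_le[of g]) auto
  then show ?thesis using eq size by (intro exI[of _ P]) (auto simp: N_def)
qed

text \<open>A pair of constant blocks with bad labels contributes at least \<open>q\<^sup>2\<close>
  bad point pairs, and \<open>n \<le> 2 * q * K\<close>; so there are at most 4 \<delta> K^2 \<le>
  \<epsilon> / 8 K^2 such pairs, whence 32 = 4 * 8. Blocks with several labels spoil at most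
  \<open>2 * card N * K\<close> pairs, again at most \<epsilon> / 8 K^2, whence 16 = 2 * 8. The
  total \<epsilon> / 4 K^2 is at most \<open>\<epsilon> * (K choose 2)\<close> because
  \<open>K \<ge> 2\<close>.\<close>

lemma ex_regular_equitable_partition:
  fixes f :: "'a \<Rightarrow> 'b" and \<epsilon> \<delta> :: real
  assumes V: "finite V" and K: "2 \<le> K" "K \<le> card V"
    and bad: "real (card {(u, v). u \<in> V \<and> v \<in> V \<and> bad (f u) (f v)}) \<le> \<delta> * (real (card V))\<^sup>2"
    and \<delta>: "32 * \<delta> \<le> \<epsilon>" and M: "16 * real (card (f ` V)) \<le> \<epsilon> * K"
  shows "\<exists>P. equitable_partition V K P \<and> (\<forall>i\<in>{1..K}. P i \<noteq> {}) \<and>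
    real (card {(i, j). 1 \<le> i \<and> i < j \<and> j \<le> K \<and> 
        \<not> (\<exists>l l'. (\<forall>u\<in>P i. f u = l) \<and> (\<forall>v\<in>P j. f v = l') \<and> \<not> bad l l')})
      \<le> \<epsilon> * real (K choose 2)"
proof -
  define n where "n = card V"
  define q where "q = n div K"
  obtain P where P: "equitable_partition V K P" "\<And>i. i \<in> {1..K} \<Longrightarrow> card (P i) \<ge> q"
    and N0: "card {i\<in>{1..K}. \<not> (\<exists>l. \<forall>v\<in>P i. f v = l)} \<le> card (f ` V)"
    using ex_equitable_partition_by_label[OF V, of K f] K unfolding q_def n_def by auto
  define N where "N = {i\<in>{1..K}. \<not> (\<exists>l. \<forall>v\<in>P i. f v = l)}"
  define Q where "Q = {(i, j). 1 \<le> i \<and> i < j \<and> j \<le> K \<and> 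
        \<not> (\<exists>l l'. (\<forall>u\<in>P i. f u = l) \<and> (\<forall>v\<in>P j. f v = l') \<and> \<not> bad l l')}"
  define Q' where "Q' = {(i, j)\<in>Q. i \<notin> N \<and> j \<notin> N}"
  have q1: "q \<ge> 1" using div_le_mono[OF K(2), of K] K(1) by (simp add: q_def n_def)
  \<comment> \<open>The remainder of \<open>n\<close> modulo \<open>K\<close> is below
    \<open>K\<close>, hence below \<open>q * K + 1\<close> because \<open>q \<ge> 1\<close>.\<close>
  have nq: "n \<le> 2 * q * K"
  proof -
    have "n < q * K + K" using dividend_less_div_times[of K n] K(1) by (simp add: q_def)
    also have "\<dots> \<le> q * K + q * K" using q1 by simp
    finally show ?thesis by simp
  qed
  have PV: "P i \<subseteq> V" if "i \<in> {1..K}" for i using P(1) that by (auto simp: equitable_partition_def)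
  have Pdisj: "P i \<inter> P j = {}" if "i \<in> {1..K}" "j \<in> {1..K}" "i \<noteq> j" for i j
    using P(1) that by (auto simp: equitable_partition_def disjoint_family_on_def)
  have fP: "finite (P i)" if "i \<in> {1..K}" for i using PV[OF that] V finite_subset by blast
  have Q_sub: "Q \<subseteq> {1..K} \<times> {1..K}" by (auto simp: Q_def)
  have Q'_sub: "Q' \<subseteq> {1..K} \<times> {1..K}" using Q_sub by (auto simp: Q'_def)
  have finQ': "finite Q'" using Q'_sub finite_subset by blast
  define T where "T = {(u, v). u \<in> V \<and> v \<in> V \<and> bad (f u) (f v)}"
  have finT: "finite T" using V by (intro finite_subset[of T "V \<times> V"]) (auto simp: T_def)
  \<comment> \<open>Double counting of bad point pairs: distinct block pairs span disjoint
    rectangles inside \<open>T\<close>.\<close>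
  have "card Q' * q\<^sup>2 = (\<Sum>p\<in>Q'. q\<^sup>2)" by simp
  also have "\<dots> \<le> (\<Sum>p\<in>Q'. card (P (fst p) \<times> P (snd p)))"
    using Q'_sub by (intro sum_mono) (auto simp: card_cartesian_product power2_eq_square intro!: mult_mono P(2))
  also have "\<dots> = card (\<Union>p\<in>Q'. P (fst p) \<times> P (snd p))"
  proof (rule card_UN_disjoint[symmetric])
    show "\<forall>p\<in>Q'. finite (P (fst p) \<times> P (snd p))" using Q'_sub fP by fastforce
    show "\<forall>p\<in>Q'. \<forall>p'\<in>Q'. p \<noteq> p' \<longrightarrow> P (fst p) \<times> P (snd p) \<inter> P (fst p') \<times> P (snd p') = {}"
    proof (intro ballI impI)
      fix p p' assume p: "p \<in> Q'" "p' \<in> Q'" "p \<noteq> p'"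
      then have "fst p \<in> {1..K}" "snd p \<in> {1..K}" "fst p' \<in> {1..K}" "snd p' \<in> {1..K}" using Q'_sub by auto
      moreover have "fst p \<noteq> fst p' \<or> snd p \<noteq> snd p'" using p(3) by (auto simp: prod_eq_iff)
      ultimately show "P (fst p) \<times> P (snd p) \<inter> P (fst p') \<times> P (snd p') = {}"
        using Pdisj[of "fst p" "fst p'"] Pdisj[of "snd p" "snd p'"] by auto
    qed
  qed (rule finQ')
  also have "\<dots> \<le> card T"
  proof (intro card_mono finT UN_least subsetI)
    fix p w assume p: "p \<in> Q'" and w: "w \<in> P (fst p) \<times> P (snd p)"
    obtain i j where ij: "p = (i, j)" by (cases p)
    obtain u v where uv: "w = (u, v)" "u \<in> P i" "v \<in> P j" using w ij by auto
    have K': "i \<in> {1..K}" "j \<in> {1..K}" using p Q'_sub ij by auto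
    have "i \<notin> N" "j \<notin> N" using p ij by (auto simp: Q'_def)
    then obtain l l' where l: "\<forall>v\<in>P i. f v = l" "\<forall>v\<in>P j. f v = l'" using K' by (auto simp: N_def)
    moreover have "\<not> (\<exists>l l'. (\<forall>u\<in>P i. f u = l) \<and> (\<forall>v\<in>P j. f v = l') \<and> \<not> bad l l')"
      using p ij by (auto simp: Q'_def Q_def)
    ultimately have "bad (f u) (f v)" using uv by metis
    then show "w \<in> T" using uv PV K' by (auto simp: T_def)
  qed
  finally have "real (card Q') * (real q)\<^sup>2 \<le> card T" by (metis of_nat_le_iff of_nat_mult of_nat_power)
  also have "\<dots> \<le> \<delta> * (real n)\<^sup>2" using bad by (simp add: T_def n_def)
  also have "\<dots> \<le> \<epsilon> / 32 * (2 * q * K)\<^sup>2"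
  proof (rule mult_mono)
    show "(real n)\<^sup>2 \<le> real ((2 * q * K)\<^sup>2)" using nq by (metis of_nat_le_iff of_nat_power power_mono zero_le)
    have "0 \<le> \<epsilon> * K" using M by (smt (verit) of_nat_0_le_iff)
    then show "0 \<le> \<epsilon> / 32" using K by (simp add: zero_le_mult_iff)
  qed (use \<delta> in auto)
  also have "\<dots> = \<epsilon> / 8 * (real K)\<^sup>2 * (real q)\<^sup>2" by (simp add: power2_eq_square)
  finally have Q': "real (card Q') \<le> \<epsilon> / 8 * (real K)\<^sup>2"
    using q1 by (simp add: mult_le_cancel_right)
  have "Q \<subseteq> N \<times> {1..K} \<union> {1..K} \<times> N \<union> Q'" using Q_sub by (auto simp: Q'_def)
  then have "card Q \<le> card (N \<times> {1..K} \<union> {1..K} \<times> N \<union> Q')"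
    using finQ' by (intro card_mono) (auto simp: N_def)
  also have "\<dots> \<le> card (N \<times> {1..K}) + card ({1..K} \<times> N) + card Q'"
    by (meson add_mono_thms_linordered_semiring(3) card_Un_le order_trans)
  also have "\<dots> = 2 * card N * K + card Q'" by (simp add: card_cartesian_product)
  finally have "real (card Q) \<le> 2 * real (card N) * K + card Q'"
    by (metis of_nat_add of_nat_le_iff of_nat_mult of_nat_numeral)
  also have "2 * real (card N) * K \<le> \<epsilon> / 8 * (real K)\<^sup>2"
  proof -
    have "16 * real (card N) \<le> \<epsilon> * K" using N0 M by (simp add: N_def)
    then have "16 * real (card N) * K \<le> \<epsilon> * K * K" by (rule mult_right_mono) simp
    then show ?thesis by (simp add: power2_eq_square)
  qed
  also have "\<epsilon> / 8 * (real K)\<^sup>2 + real (card Q') \<le> \<epsilon> / 4 * (real K)\<^sup>2" using Q' by simp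
  also have "\<dots> \<le> \<epsilon> * real (K choose 2)"
  proof -
    have e: "0 \<le> \<epsilon>" using M K by (smt (verit) mult_neg_pos of_nat_0_le_iff of_nat_0_less_iff pos2 less_le_trans)
    have "real (K choose 2) = real K * (real K - 1) / 2"
      using K by (simp add: choose_two real_of_nat_div of_nat_diff)
    moreover have "(real K)\<^sup>2 / 4 \<le> real K * (real K - 1) / 2"
    proof -
      have "real K * 2 \<le> real K * real K" using K by (intro mult_left_mono) auto
      then show ?thesis by (simp add: power2_eq_square algebra_simps)
    qed
    ultimately have "\<epsilon> * ((real K)\<^sup>2 / 4) \<le> \<epsilon> * real (K choose 2)" using e by (intro mult_left_mono) auto
    then show ?thesis by simp
  qed
  finally have "real (card Q) \<le> \<epsilon> * real (K choose 2)" by simp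
  moreover have "P i \<noteq> {}" if "i \<in> {1..K}" for i using P(2)[OF that] q1 by auto
  ultimately show ?thesis using P(1) unfolding Q_def by blast
qed

section \<open>Polynomial bounds\<close>

lemma power_div_fact_le_exp:
  fixes x :: real
  assumes "0 \<le> x"
  shows "x ^ n / fact n \<le> exp x"
proof -
  have "(\<Sum>k\<in>{n}. inverse (fact k) *\<^sub>R x ^ k) \<le> suminf (\<lambda>k. inverse (fact k) *\<^sub>R x ^ k)"
    using assms by (intro sum_le_suminf summable_exp_generic) auto
  then show ?thesis by (simp add: exp_def divide_inverse mult.commute)
qed

text \<open>Put \<open>s = q + u\<close> with \<open>u \<ge> r\<^sup>2\<close>. Then the failure
  factor is at most \<open>exp (- sqrt u)\<close>, while the number of candidates is at most a
  constant times \<open>u ^ q\<close>. A single term of the exponential series, of degree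
  \<open>2 * q + 2\<close> in \<open>sqrt u\<close>, outgrows this as soon as \<open>u\<close>
  exceeds a constant that depends on \<open>d\<close> alone.\<close>

lemma ex_sample_size:
  fixes d :: nat
  shows "\<exists>S. \<forall>r\<ge>1::real. \<exists>s. real s \<le> S + r\<^sup>2 \<and>
    real ((3 * (s + d + 1) ^ d) ^ 2 ^ d) * (1 - 1 / r) ^ (s - 2 ^ d * d) < 1"
proof -
  define q where "q = 2 ^ d * d"
  \<comment> \<open>\<open>A\<close> collects all constants, so that
    \<open>Y * fact (2 * q + 2) \<le> A * u ^ q\<close> below.\<close>
  define A :: nat where "A = 3 ^ 2 ^ d * (q + d + 2) ^ q * fact (2 * q + 2)"
  have "\<exists>s. real s \<le> real (q + A + 2) + r\<^sup>2 \<and>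
    real ((3 * (s + d + 1) ^ d) ^ 2 ^ d) * (1 - 1 / r) ^ (s - q) < 1" if r: "r \<ge> 1" for r :: real
  proof -
    define u where "u = max (A + 1) (nat \<lceil>r\<^sup>2\<rceil>)"
    have uA: "u > A" "u \<ge> 1" by (auto simp: u_def)
    have "nat \<lceil>r\<^sup>2\<rceil> \<le> u" by (simp add: u_def)
    then have ur: "r\<^sup>2 \<le> u" using real_nat_ceiling_ge[of "r\<^sup>2"] by linarith
    have u_le: "real u \<le> real A + 2 + r\<^sup>2"
    proof -
      have "u = A + 1 \<or> u = nat \<lceil>r\<^sup>2\<rceil>" by (simp add: u_def max_def)
      moreover have "real (nat \<lceil>r\<^sup>2\<rceil>) \<le> r\<^sup>2 + 1" using of_int_ceiling_le_add_one[of "r\<^sup>2"] by simp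
      ultimately show ?thesis using zero_le_power2[of r] by (elim disjE) (simp only:, linarith)+
    qed
    have "r \<le> sqrt u" using ur real_le_rsqrt by blast
    then have "r * sqrt u \<le> sqrt u * sqrt u" by (intro mult_right_mono) auto
    then have x: "sqrt u \<le> u / r" using r by (simp add: field_simps)
    have "(1 - 1 / r) ^ u \<le> exp (- (1 / r)) ^ u"
      using r exp_ge_add_one_self[of "- (1 / r)"] by (intro power_mono) auto
    also have "\<dots> = exp (- (u / r))" by (simp flip: exp_of_nat_mult)
    also have "\<dots> \<le> exp (- sqrt u)" using x by simp
    finally have e1: "(1 - 1 / r) ^ u \<le> exp (- sqrt u)" .
    have "real u ^ (q + 1) = sqrt u ^ (2 * q + 2)"
    proof -
      have e: "2 * q + 2 = 2 * (q + 1)" by simp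
      show ?thesis unfolding e power_mult by simp
    qed
    then have e2: "real u ^ (q + 1) / fact (2 * q + 2) \<le> exp (sqrt u)"
      using power_div_fact_le_exp[of "sqrt u" "2 * q + 2"] by simp
    define Y where "Y = (3 * (q + u + d + 1) ^ d) ^ 2 ^ d"
    have "Y = 3 ^ 2 ^ d * (q + u + d + 1) ^ q"
      by (simp add: Y_def power_mult_distrib q_def mult.commute flip: power_mult)
    also have "\<dots> \<le> 3 ^ 2 ^ d * (u * (q + d + 2)) ^ q"
    proof (intro mult_left_mono power_mono)
      have "(q + d + 1) * 1 \<le> (q + d + 1) * u" using uA by (intro mult_left_mono) auto
      then show "q + u + d + 1 \<le> u * (q + d + 2)" by (simp add: algebra_simps)
    qed auto
    finally have "Y * fact (2 * q + 2)
        \<le> 3 ^ 2 ^ d * (u * (q + d + 2)) ^ q * fact (2 * q + 2)"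
      by (rule mult_right_mono) simp
    also have "\<dots> = A * u ^ q" by (simp only: A_def power_mult_distrib mult_ac)
    finally have "Y * fact (2 * q + 2) \<le> A * u ^ q" .
    also have "\<dots> < u * u ^ q" using uA by (intro mult_strict_right_mono) auto
    finally have "real (Y * fact (2 * q + 2)) < real (u * u ^ q)" by (simp only: of_nat_less_iff)
    then have "real Y * fact (2 * q + 2) < real u ^ (q + 1)"
      by (simp only: of_nat_mult of_nat_fact of_nat_power power_add power_one_right mult.commute)
    then have "real Y < real u ^ (q + 1) / fact (2 * q + 2)"
      by (subst pos_less_divide_eq) (rule fact_gt_zero)
    also note e2
    finally have "real Y * exp (- sqrt u) < exp (sqrt u) * exp (- sqrt u)"
      by (intro mult_strict_right_mono) auto
    also have "\<dots> = 1" by (simp flip: exp_add)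
    finally have "real Y * exp (- sqrt u) < 1" .
    moreover have "real Y * (1 - 1 / r) ^ u
        \<le> real Y * exp (- sqrt u)"
      by (intro mult_left_mono e1) simp
    ultimately have "real Y * (1 - 1 / r) ^ u < 1" by linarith
    then show ?thesis using u_le unfolding Y_def by (intro exI[of _ "q + u"]) simp
  qed
  then show ?thesis unfolding q_def by blast
qed

section \<open>Functions of polynomial growth\<close>

definition poly_bounded :: "(real \<Rightarrow> real) \<Rightarrow> bool" where
  "poly_bounded f \<longleftrightarrow> (\<exists>k::nat. \<forall>z\<ge>2. 0 \<le> f z \<and> f z \<le> z ^ k)"

text \<open>The threshold 2 in \<open>poly_bounded\<close> allows constants to be absorbed into the
  exponent; it fits because m / \<epsilon> exceeds 2.\<close>

lemma poly_bounded_const: "0 \<le> a \<Longrightarrow> poly_bounded (\<lambda>_. a)"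
proof -
  assume a: "0 \<le> a"
  obtain k where "a < 2 ^ k" using real_arch_pow[of 2 a] by auto
  moreover have "(2::real) ^ k \<le> z ^ k" if "z \<ge> 2" for z using that by (intro power_mono) auto
  ultimately show ?thesis using a unfolding poly_bounded_def by (meson less_le_trans less_imp_le)
qed

lemma poly_bounded_ident: "poly_bounded (\<lambda>z. z)"
  unfolding poly_bounded_def by (intro exI[of _ 1]) auto

lemma poly_bounded_add:
  assumes "poly_bounded f" "poly_bounded g"
  shows "poly_bounded (\<lambda>z. f z + g z)"
proof -
  obtain j k where jk: "\<forall>z\<ge>2. 0 \<le> f z \<and> f z \<le> z ^ j" "\<forall>z\<ge>2. 0 \<le> g z \<and> g z \<le> z ^ k"
    using assms by (auto simp: poly_bounded_def)
  have "0 \<le> f z + g z \<and> f z + g z \<le> z ^ (max j k + 1)" if "z \<ge> 2" for z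
  proof -
    have "z ^ j \<le> z ^ max j k" "z ^ k \<le> z ^ max j k" using that by (auto intro: power_increasing)
    moreover have "2 * z ^ max j k \<le> z * z ^ max j k" using that by (intro mult_right_mono) auto
    ultimately show ?thesis using jk that by (simp; smt (verit))
  qed
  then show ?thesis unfolding poly_bounded_def by blast
qed

lemma poly_bounded_mult:
  assumes "poly_bounded f" "poly_bounded g"
  shows "poly_bounded (\<lambda>z. f z * g z)"
proof -
  obtain j k where jk: "\<forall>z\<ge>2. 0 \<le> f z \<and> f z \<le> z ^ j" "\<forall>z\<ge>2. 0 \<le> g z \<and> g z \<le> z ^ k"
    using assms by (auto simp: poly_bounded_def)
  have "0 \<le> f z * g z \<and> f z * g z \<le> z ^ (j + k)" if "z \<ge> 2" for z
    unfolding power_add using jk that by (auto intro!: mult_mono)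
  then show ?thesis unfolding poly_bounded_def by blast
qed

lemma poly_bounded_power: "poly_bounded f \<Longrightarrow> poly_bounded (\<lambda>z. f z ^ n)"
  by (induction n) (auto intro: poly_bounded_mult poly_bounded_const)

section \<open>Partitions for semi-algebraic relations\<close>

lemma holds_cong: "(\<And>a. a \<in> atoms \<Phi> \<Longrightarrow> b a = b' a) \<Longrightarrow> holds b \<Phi> = holds b' \<Phi>"
  by (induction \<Phi>) auto

text \<open>A single pair \<open>u0\<close>, \<open>v0\<close> has some color \<open>k\<close> by
  \<open>cover\<close>. All sign conditions in the formula of \<open>E k\<close> are constant on
  \<open>X \<times> Y\<close>, so every other pair inherits this color. Disjointness yields
  \<open>u \<noteq> v\<close>, without which the formula says nothing about membership.\<close>

lemma complete_pair_of_labels: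
  assumes rel: "\<forall>k\<in>{1..m}. E k \<subseteq> nsets V 2 \<and> atoms (\<Phi> k) \<subseteq> {..<length (gs k)} \<and>
      (\<forall>u\<in>V. \<forall>v\<in>V. u \<noteq> v \<longrightarrow> ({u, v} \<in> E k \<longleftrightarrow> semialg_holds (gs k) (\<Phi> k) u v))"
    and cover: "nsets V 2 = (\<Union>k\<in>{1..m}. E k)"
    and P: "X \<subseteq> V" "Y \<subseteq> V" "X \<inter> Y = {}" "X \<noteq> {}" "Y \<noteq> {}"
    and hom: "\<And>k l u v u' v'. k \<in> {1..m} \<Longrightarrow> l < length (gs k) \<Longrightarrow> u \<in> X \<Longrightarrow> u' \<in> X \<Longrightarrow>
      v \<in> Y \<Longrightarrow> v' \<in> Y \<Longrightarrow> 0 \<le> eval_pair (gs k ! l) u v \<longleftrightarrow> 0 \<le> eval_pair (gs k ! l) u' v'"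
  shows "\<exists>k\<in>{1..m}. complete_pair (E k) X Y"
proof -
  obtain u0 v0 where uv0: "u0 \<in> X" "v0 \<in> Y" using P by blast
  have ne: "u \<noteq> v" if "u \<in> X" "v \<in> Y" for u v using P(3) that by blast
  have "{u0, v0} \<in> nsets V 2" using uv0 P ne[OF uv0] by (auto simp: nsets_def)
  then obtain k where k: "k \<in> {1..m}" "{u0, v0} \<in> E k" using cover by blast
  note relk = bspec[OF rel k(1)]
  have "{u, v} \<in> E k" if uv: "u \<in> X" "v \<in> Y" for u v
  proof -
    have "semialg_holds (gs k) (\<Phi> k) u v \<longleftrightarrow> semialg_holds (gs k) (\<Phi> k) u0 v0"
      unfolding semialg_holds_def
    proof (rule holds_cong)
      fix l assume "l \<in> atoms (\<Phi> k)"
      then have "l < length (gs k)" using relk by blast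
      then show "(0 \<le> eval_pair (gs k ! l) u v) = (0 \<le> eval_pair (gs k ! l) u0 v0)"
        by (rule hom[OF k(1) _ uv(1) uv0(1) uv(2) uv0(2)])
    qed
    moreover have "{u0, v0} \<in> E k \<longleftrightarrow> semialg_holds (gs k) (\<Phi> k) u0 v0"
      using relk uv0 P(1,2) ne[OF uv0] by blast
    moreover have "{u, v} \<in> E k \<longleftrightarrow> semialg_holds (gs k) (\<Phi> k) u v"
      using relk uv P(1,2) ne[OF uv] by blast
    ultimately show ?thesis using k(2) by blast
  qed
  then show ?thesis using k(1) unfolding complete_pair_def by blast
qed

text \<open>This settles point sets that are too small for \<open>K\<close> nonempty blocks. Two
  singletons span one pair, which is colored by \<open>cover\<close>; a pair with an empty part is
  complete vacuously, provided there is a color at all.\<close>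

lemma ex_partition_into_singletons:
  assumes V: "finite V" and K: "card V \<le> K"
    and cover: "nsets V 2 = (\<Union>k\<in>{1..m}. E k)" and m: "m \<ge> (1::nat)"
  shows "\<exists>P. equitable_partition V K P \<and> (card V = K \<longrightarrow> (\<forall>i\<in>{1..K}. P i \<noteq> {})) \<and>
    {(i, j). 1 \<le> i \<and> i < j \<and> j \<le> K \<and> \<not> (\<exists>k\<in>{1..m}. complete_pair (E k) (P i) (P j))} = {}"
proof -
  obtain e where e: "bij_betw e {1..card V} V" using ex_bij_betw_nat_finite_1[OF V] by blast
  define P where "P = (\<lambda>i. if i \<le> card V then {e i} else {})"
  have inj: "e i = e j \<Longrightarrow> i = j" if "i \<in> {1..card V}" "j \<in> {1..card V}" for i j
    using e that by (auto simp: bij_betw_def dest: inj_onD)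
  have img: "V = e ` {1..card V}" using e by (simp add: bij_betw_def)
  have UN: "V = (\<Union>i\<in>{1..K}. P i)"
  proof
    show "V \<subseteq> (\<Union>i\<in>{1..K}. P i)"
    proof
      fix v assume "v \<in> V"
      then obtain i where "i \<in> {1..card V}" "v = e i" using img by blast
      then show "v \<in> (\<Union>i\<in>{1..K}. P i)" using K by (intro UN_I[of i]) (auto simp: P_def)
    qed
    have "e i \<in> V" if "i \<in> {1..card V}" for i using img that by blast
    then show "(\<Union>i\<in>{1..K}. P i) \<subseteq> V" by (auto simp: P_def)
  qed
  have disj: "disjoint_family_on P {1..K}"
    unfolding disjoint_family_on_def using inj by (auto simp: P_def)
  have "card (P i) \<le> card (P j) + 1" for i j by (simp add: P_def)
  then have "equitable_partition V K P" using UN disj by (simp add: equitable_partition_def)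
  moreover have "\<exists>k\<in>{1..m}. complete_pair (E k) (P i) (P j)" if ij: "1 \<le> i" "i < j" "j \<le> K" for i j
  proof (cases "j \<le> card V")
    case True
    then have ij': "i \<in> {1..card V}" "j \<in> {1..card V}" "i \<noteq> j" using ij by auto
    then have "e i \<noteq> e j" using inj by blast
    moreover have "e i \<in> V" "e j \<in> V" using img ij' by blast+
    ultimately have "{e i, e j} \<in> nsets V 2" by (auto simp: nsets_def)
    then obtain k where "k \<in> {1..m}" "{e i, e j} \<in> E k" using cover by blast
    then show ?thesis using ij' by (intro bexI[of _ k]) (auto simp: complete_pair_def P_def)
  next
    case False
    then show ?thesis using m by (intro bexI[of _ 1]) (auto simp: complete_pair_def P_def)
  qed
  ultimately show ?thesis by (intro exI[of _ P]) (auto simp: P_def)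
qed

text \<open>The value of \<open>r\<close> is chosen so that 32 times the density
  \<open>1 / r * card J\<close> of bad point pairs equals \<epsilon>, where \<open>J\<close> indexes
  colors and atoms.\<close>

lemma semialgebraic_regular_partition:
  fixes V :: "(real ^ 'd) set" and E :: "nat \<Rightarrow> (real ^ 'd) set set" and \<epsilon> r :: real and d t s m :: nat
  defines "d \<equiv> card (monomial_basis t :: (('d \<Rightarrow>\<^sub>0 nat) \<Rightarrow>\<^sub>0 real) set)"
  defines "g \<equiv> 3 * (s + d + 1) ^ d"
  assumes t: "t \<ge> 1" and m: "m \<ge> 1" and \<epsilon>: "0 < \<epsilon>" and V: "finite V"
    and rel: "\<forall>k\<in>{1..m}. semialgebraic_relation t V (E k)"
    and cover: "nsets V 2 = (\<Union>k\<in>{1..m}. E k)"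
    and r: "r = 32 * real t * (real m / \<epsilon>)" "1 \<le> r"
    and s: "real (g ^ 2 ^ d) * (1 - 1 / r) ^ (s - 2 ^ d * d) < 1"
    and K: "2 \<le> K" "K \<le> card V" "16 * real (g ^ 2 ^ d * (m * t * g + 1) ^ d) \<le> \<epsilon> * K"
  shows "\<exists>P. equitable_partition V K P \<and> (\<forall>i\<in>{1..K}. P i \<noteq> {}) \<and>
    real (card {(i, j). 1 \<le> i \<and> i < j \<and> j \<le> K \<and> \<not> (\<exists>k\<in>{1..m}. complete_pair (E k) (P i) (P j))})
      \<le> \<epsilon> * real (K choose 2)"
proof -
  let ?B = "monomial_basis t :: (('d \<Rightarrow>\<^sub>0 nat) \<Rightarrow>\<^sub>0 real) set"
  have "\<forall>k\<in>{1..m}. \<exists>p. length (fst p) \<le> t \<and> (\<forall>g\<in>set (fst p). total_degree g \<le> t) \<and>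
      E k \<subseteq> nsets V 2 \<and> atoms (snd p) \<subseteq> {..<length (fst p)} \<and>
      (\<forall>u\<in>V. \<forall>v\<in>V. u \<noteq> v \<longrightarrow> ({u, v} \<in> E k \<longleftrightarrow> semialg_holds (fst p) (snd p) u v))"
    using rel unfolding semialgebraic_relation_def by (metis fst_conv snd_conv)
  from bchoice[OF this] obtain p where p: "\<forall>k\<in>{1..m}. length (fst (p k)) \<le> t \<and>
      (\<forall>g\<in>set (fst (p k)). total_degree g \<le> t) \<and>
      E k \<subseteq> nsets V 2 \<and> atoms (snd (p k)) \<subseteq> {..<length (fst (p k))} \<and>
      (\<forall>u\<in>V. \<forall>v\<in>V. u \<noteq> v \<longrightarrow> ({u, v} \<in> E k \<longleftrightarrow> semialg_holds (fst (p k)) (snd (p k)) u v))"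
    by (elim exE) (rule that)
  define gs where "gs = (\<lambda>k. fst (p k))"
  define \<Phi> where "\<Phi> = (\<lambda>k. snd (p k))"
  have len: "length (gs k) \<le> t" and deg: "\<forall>g\<in>set (gs k). total_degree g \<le> t" if "k \<in> {1..m}" for k
    using bspec[OF p that] by (simp_all add: gs_def)
  have relE: "\<forall>k\<in>{1..m}. E k \<subseteq> nsets V 2 \<and> atoms (\<Phi> k) \<subseteq> {..<length (gs k)} \<and>
      (\<forall>u\<in>V. \<forall>v\<in>V. u \<noteq> v \<longrightarrow> ({u, v} \<in> E k \<longleftrightarrow> semialg_holds (gs k) (\<Phi> k) u v))"
    unfolding gs_def \<Phi>_def using p by simp
  \<comment> \<open>Colors with fewer than \<open>t\<close> polynomials are padded by the zero
    polynomial, so that one index set of size \<open>m * t\<close> serves all colors.\<close>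
  define G where "G = (\<lambda>(k, l). if l < length (gs k) then gs k ! l else 0)"
  define J where "J = {1..m} \<times> {..<t}"
  have "(1, 0) \<in> J" using t m by (simp add: J_def)
  then have J: "finite J" "J \<noteq> {}" "card J = m * t" by (auto simp: J_def card_cartesian_product)
  have degG: "total_degree (G j) \<le> t" if j: "j \<in> J" for j
  proof -
    obtain k l where kl: "j = (k, l)" "k \<in> {1..m}" using j by (auto simp: J_def)
    have "total_degree (0 :: ('d + 'd) real_mpoly) \<le> t" by (simp add: total_degree_def)
    then show ?thesis using deg[OF kl(2)] by (simp add: kl(1) G_def)
  qed
  have Vne: "V \<noteq> {}" using K by auto
  have r0: "0 \<le> 1 / r" "1 / r \<le> 1" using r(2) by auto
  have "\<exists>(f :: real ^ 'd \<Rightarrow> (('d \<Rightarrow>\<^sub>0 nat) \<Rightarrow>\<^sub>0 real) list \<times> ((nat \<times> nat) \<times> (('d \<Rightarrow>\<^sub>0 nat) \<Rightarrow>\<^sub>0 real)) set) bad.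
    card (f ` V) \<le> g ^ 2 ^ d * (card J * g + 1) ^ d \<and>
    real (card {(u, v). u \<in> V \<and> v \<in> V \<and> bad (f u) (f v)}) \<le> 1 / r * card J * (real (card V))\<^sup>2 \<and>
    (\<forall>u\<in>V. \<forall>v\<in>V. \<forall>u'\<in>V. \<forall>v'\<in>V. \<forall>j\<in>J. f u = f u' \<longrightarrow> f v = f v' \<longrightarrow> \<not> bad (f u) (f v) \<longrightarrow>
      (0 \<le> contract_right (G j) (veronese t v) \<bullet> veronese t u \<longleftrightarrow>
       0 \<le> contract_right (G j) (veronese t v') \<bullet> veronese t u'))"
    unfolding d_def g_def
    by (rule ex_cell_and_sign_labelling[where hr = "\<lambda>j. contract_left (G j)",
          OF finite_monomial_basis V Vne J(1,2) veronese_in_span veronese_nonzero _ contract_adjoint r0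
            s[unfolded g_def d_def]])
      (rule contract_right_in_span[OF degG])
  then obtain f :: "real ^ 'd \<Rightarrow> (('d \<Rightarrow>\<^sub>0 nat) \<Rightarrow>\<^sub>0 real) list \<times> ((nat \<times> nat) \<times> (('d \<Rightarrow>\<^sub>0 nat) \<Rightarrow>\<^sub>0 real)) set"
    and bad where f: "card (f ` V) \<le> g ^ 2 ^ d * (card J * g + 1) ^ d"
      "real (card {(u, v). u \<in> V \<and> v \<in> V \<and> bad (f u) (f v)}) \<le> 1 / r * card J * (real (card V))\<^sup>2"
      "\<forall>u\<in>V. \<forall>v\<in>V. \<forall>u'\<in>V. \<forall>v'\<in>V. \<forall>j\<in>J. f u = f u' \<longrightarrow> f v = f v' \<longrightarrow> \<not> bad (f u) (f v) \<longrightarrow>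
        (0 \<le> contract_right (G j) (veronese t v) \<bullet> veronese t u \<longleftrightarrow>
         0 \<le> contract_right (G j) (veronese t v') \<bullet> veronese t u')"
    by (elim exE conjE) (rule that)
  have \<delta>: "32 * (1 / r * card J) \<le> \<epsilon>" using t m \<epsilon> by (simp add: J(3) r(1) field_simps)
  have "real (card (f ` V)) \<le> real (g ^ 2 ^ d * (m * t * g + 1) ^ d)"
    using f(1) unfolding J(3) by (simp only: of_nat_le_iff)
  then have M: "16 * real (card (f ` V)) \<le> \<epsilon> * K" using K(3) by linarith
  obtain P where P: "equitable_partition V K P" "\<forall>i\<in>{1..K}. P i \<noteq> {}"
    "real (card {(i, j). 1 \<le> i \<and> i < j \<and> j \<le> K \<and>
        \<not> (\<exists>l l'. (\<forall>u\<in>P i. f u = l) \<and> (\<forall>v\<in>P j. f v = l') \<and> \<not> bad l l')})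
      \<le> \<epsilon> * real (K choose 2)"
    using ex_regular_equitable_partition[OF V K(1,2) f(2) \<delta> M] by (elim exE conjE) (rule that)
  have hom: "0 \<le> eval_pair (gs k ! l) u v \<longleftrightarrow> 0 \<le> eval_pair (gs k ! l) u' v'"
    if kl: "k \<in> {1..m}" "l < length (gs k)" and uv: "u \<in> V" "v \<in> V" "u' \<in> V" "v' \<in> V"
      and eq: "f u = f u'" "f v = f v'" "\<not> bad (f u) (f v)" for k l u v u' v'
  proof -
    have j: "(k, l) \<in> J" using kl len[OF kl(1)] by (auto simp: J_def)
    have G: "gs k ! l = G (k, l)" using kl by (simp add: G_def)
    show ?thesis unfolding G eval_pair_eq_inner[OF degG[OF j]]
      using f(3)[rule_format, OF uv j eq] .
  qed
  have good: "\<exists>k\<in>{1..m}. complete_pair (E k) (P i) (P j)"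
    if ij: "1 \<le> i" "i < j" "j \<le> K"
      and l: "\<forall>u\<in>P i. f u = l" "\<forall>v\<in>P j. f v = l'" "\<not> bad l l'" for i j l l'
  proof (rule complete_pair_of_labels[OF relE cover])
    have ij': "i \<in> {1..K}" "j \<in> {1..K}" "i \<noteq> j" using ij by auto
    show sub: "P i \<subseteq> V" "P j \<subseteq> V" using P(1) ij' by (auto simp: equitable_partition_def)
    show "P i \<inter> P j = {}" using P(1) ij' by (auto simp: equitable_partition_def disjoint_family_on_def)
    show "P i \<noteq> {}" "P j \<noteq> {}" using P(2) ij' by auto
    fix k q u v u' v'
    assume "k \<in> {1..m}" "q < length (gs k)" "u \<in> P i" "u' \<in> P i" "v \<in> P j" "v' \<in> P j"
    then show "0 \<le> eval_pair (gs k ! q) u v \<longleftrightarrow> 0 \<le> eval_pair (gs k ! q) u' v'"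
      using sub l by (intro hom) auto
  qed
  have "card {(i, j). 1 \<le> i \<and> i < j \<and> j \<le> K \<and> \<not> (\<exists>k\<in>{1..m}. complete_pair (E k) (P i) (P j))}
    \<le> card {(i, j). 1 \<le> i \<and> i < j \<and> j \<le> K \<and>
        \<not> (\<exists>l l'. (\<forall>u\<in>P i. f u = l) \<and> (\<forall>v\<in>P j. f v = l') \<and> \<not> bad l l')}"
  proof (rule card_mono)
    show "finite {(i, j). 1 \<le> i \<and> i < j \<and> j \<le> K \<and>
        \<not> (\<exists>l l'. (\<forall>u\<in>P i. f u = l) \<and> (\<forall>v\<in>P j. f v = l') \<and> \<not> bad l l')}"
      by (rule finite_subset[of _ "{1..K} \<times> {1..K}"]) auto
  qed (use good in blast)
  then have "real (card {(i, j). 1 \<le> i \<and> i < j \<and> j \<le> K \<and> \<not> (\<exists>k\<in>{1..m}. complete_pair (E k) (P i) (P j))})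
    \<le> \<epsilon> * real (K choose 2)" using P(3) by linarith
  then show ?thesis using P(1,2) by blast
qed

theorem theorem1p2:
  fixes t :: nat
  assumes "t \<ge> 1"
  shows "\<exists>c::real. c > 0 \<and>
    (\<forall>(\<epsilon>::real) (m::nat) (V::(real ^ 'd) set) (E::nat \<Rightarrow> (real ^ 'd) set set).
       0 < \<epsilon> \<longrightarrow> \<epsilon> < 1 / 2 \<longrightarrow> m \<ge> 1 \<longrightarrow> finite V \<longrightarrow>
       (\<forall>k\<in>{1..m}. semialgebraic_relation t V (E k)) \<longrightarrow>
       nsets V 2 = (\<Union>k\<in>{1..m}. E k) \<longrightarrow>
       (\<exists>(K::nat) (P::nat \<Rightarrow> (real ^ 'd) set).
          equitable_partition V K P \<and>
          (4 / \<epsilon> \<le> real (card V) \<longrightarrow> (\<forall>i\<in>{1..K}. P i \<noteq> {})) \<and>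
          4 / \<epsilon> \<le> real K \<and> real K \<le> (real m / \<epsilon>) powr c \<and>
          real (card {(i, j). 1 \<le> i \<and> i < j \<and> j \<le> K \<and>
                        \<not> (\<exists>k\<in>{1..m}. complete_pair (E k) (P i) (P j))})
            \<le> \<epsilon> * real (K choose 2)))"
proof -
  define d where "d = card (monomial_basis t :: (('d \<Rightarrow>\<^sub>0 nat) \<Rightarrow>\<^sub>0 real) set)"
  obtain S where S: "\<forall>r\<ge>1::real. \<exists>s. real s \<le> S + r\<^sup>2 \<and>
      real ((3 * (s + d + 1) ^ d) ^ 2 ^ d) * (1 - 1 / r) ^ (s - 2 ^ d * d) < 1"
    using ex_sample_size by blast
  \<comment> \<open>\<open>G\<close> and \<open>L\<close> bound the number of rays and the required
    number of parts by functions of the real \<open>z = m / \<epsilon>\<close>. In \<open>L\<close>,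
    the first summand makes the labels few compared with \<open>\<epsilon> * K\<close>, and
    \<open>4 * z\<close> secures the lower bound on \<open>K\<close>. The absolute value provides
    the nonnegativity that \<open>poly_bounded\<close> asks for.\<close>
  define G where "G = (\<lambda>z::real. 3 * ((\<bar>S\<bar> + (32 * real t * z)\<^sup>2) + real d + 1) ^ d)"
  define L where "L = (\<lambda>z. 16 * z * (G z ^ 2 ^ d * (z * real t * G z + 1) ^ d) + 4 * z)"
  have "poly_bounded (\<lambda>z. L z + 2)"
    unfolding L_def G_def
    by (intro poly_bounded_add poly_bounded_mult poly_bounded_power poly_bounded_const poly_bounded_ident) auto
  then obtain q :: nat where q: "\<forall>z\<ge>2. 0 \<le> L z + 2 \<and> L z + 2 \<le> z ^ q"
    unfolding poly_bounded_def by blast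
  show ?thesis
  \<comment> \<open>The summand 1 makes the exponent positive without a look at
    \<open>q\<close>.\<close>
  proof (intro exI[of _ "real q + 1"] conjI allI impI)
    show "real q + 1 > 0" by simp
    fix \<epsilon> :: real and m :: nat and V :: "(real ^ 'd) set" and E :: "nat \<Rightarrow> (real ^ 'd) set set"
    assume \<epsilon>: "0 < \<epsilon>" "\<epsilon> < 1 / 2" and m: "m \<ge> 1" and V: "finite V"
      and rel: "\<forall>k\<in>{1..m}. semialgebraic_relation t V (E k)"
      and cover: "nsets V 2 = (\<Union>k\<in>{1..m}. E k)"
    define z where "z = real m / \<epsilon>"
    have z: "1 / \<epsilon> \<le> z" "real m \<le> z" "2 \<le> z"
    proof -
      show *: "1 / \<epsilon> \<le> z" using m \<epsilon> by (simp add: z_def divide_right_mono)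
      show "real m \<le> z" using m \<epsilon> by (simp add: z_def field_simps)
      have "2 \<le> 1 / \<epsilon>" using \<epsilon> by (simp add: field_simps)
      then show "2 \<le> z" using * by linarith
    qed
    define r where "r = 32 * real t * z"
    have r1: "1 \<le> r"
    proof -
      have "1 * 1 \<le> (32 * real t) * z" using assms z(3) by (intro mult_mono) auto
      then show ?thesis by (simp add: r_def)
    qed
    obtain s where s: "real s \<le> S + r\<^sup>2"
      "real ((3 * (s + d + 1) ^ d) ^ 2 ^ d) * (1 - 1 / r) ^ (s - 2 ^ d * d) < 1"
      using S r1 by blast
    define g where "g = 3 * (s + d + 1) ^ d"
    have g: "real g \<le> G z"
    proof -
      have "real s \<le> \<bar>S\<bar> + (32 * real t * z)\<^sup>2" using s(1) unfolding r_def by linarith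
      then have "real (s + d + 1) ^ d \<le> ((\<bar>S\<bar> + (32 * real t * z)\<^sup>2) + real d + 1) ^ d"
        by (intro power_mono) auto
      then show ?thesis by (simp add: g_def G_def)
    qed
    define M where "M = g ^ 2 ^ d * (m * t * g + 1) ^ d"
    have M: "real M \<le> G z ^ 2 ^ d * (z * real t * G z + 1) ^ d"
    proof -
      have "real m * real t * real g + 1 \<le> z * real t * G z + 1"
        using z g by (intro add_right_mono mult_mono) auto
      then have "real g ^ 2 ^ d * (real m * real t * real g + 1) ^ d \<le> G z ^ 2 ^ d * (z * real t * G z + 1) ^ d"
        using g by (intro mult_mono power_mono) auto
      then show ?thesis by (simp add: M_def add.commute)
    qed
    define K where "K = nat \<lceil>L z\<rceil> + 1"
    have LM: "16 * z * real M + 4 * z \<le> L z"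
      unfolding L_def using M z by (intro add_right_mono mult_left_mono) auto
    have L0: "8 \<le> L z"
    proof -
      have "0 \<le> 16 * z * real M" using z(3) by simp
      then show ?thesis using LM z(3) by linarith
    qed
    have K_ge: "L z \<le> real K" and K_le: "real K \<le> L z + 2"
    proof -
      have "real (nat \<lceil>L z\<rceil>) \<le> L z + 1"
        using L0 of_int_ceiling_le_add_one[of "L z"] by simp
      then show "L z \<le> real K" "real K \<le> L z + 2"
        using real_nat_ceiling_ge[of "L z"] unfolding K_def of_nat_add by linarith+
    qed
    have K_powr: "real K \<le> z powr (real q + 1)"
    proof -
      have "real K \<le> z ^ q" using K_le q z(3) by force
      also have "\<dots> = z powr real q" using z(3) by (simp add: powr_realpow)
      also have "\<dots> \<le> z powr (real q + 1)" using z(3) by (intro powr_mono) auto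
      finally show ?thesis .
    qed
    have K4: "4 / \<epsilon> \<le> L z"
    proof -
      have "4 / \<epsilon> \<le> 4 * z" using z(1) by simp
      moreover have "0 \<le> 16 * z * real M" using z(3) by simp
      ultimately show ?thesis using LM by linarith
    qed
    show "\<exists>K P. equitable_partition V K P \<and>
          (4 / \<epsilon> \<le> real (card V) \<longrightarrow> (\<forall>i\<in>{1..K}. P i \<noteq> {})) \<and>
          4 / \<epsilon> \<le> real K \<and> real K \<le> (real m / \<epsilon>) powr (real q + 1) \<and>
          real (card {(i, j). 1 \<le> i \<and> i < j \<and> j \<le> K \<and>
                        \<not> (\<exists>k\<in>{1..m}. complete_pair (E k) (P i) (P j))})
            \<le> \<epsilon> * real (K choose 2)"
    proof (cases "K \<le> card V")
      case True
      have K2: "2 \<le> K" using L0 K_ge by linarith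
      have KM: "16 * real M \<le> \<epsilon> * real K"
      proof -
        have "16 * (1 / \<epsilon>) * real M \<le> 16 * z * real M" using z by (intro mult_right_mono) auto
        also have "\<dots> \<le> real K" using LM K_ge z(3) by linarith
        finally show ?thesis using \<epsilon> by (simp add: field_simps)
      qed
      obtain P where P: "equitable_partition V K P" "\<forall>i\<in>{1..K}. P i \<noteq> {}"
        "real (card {(i, j). 1 \<le> i \<and> i < j \<and> j \<le> K \<and> \<not> (\<exists>k\<in>{1..m}. complete_pair (E k) (P i) (P j))})
          \<le> \<epsilon> * real (K choose 2)"
        using semialgebraic_regular_partition[OF assms m \<epsilon>(1) V rel cover r_def[unfolded z_def] r1
            s(2)[unfolded d_def] K2 True KM[unfolded M_def g_def d_def]]
        by (elim exE conjE) (rule that)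
      then show ?thesis using K4 K_ge K_powr unfolding z_def
        by (intro exI[of _ K] exI[of _ P] conjI) auto
    next
      case False
      \<comment> \<open>With fewer than \<open>K\<close> points, singletons suffice. The maximum
        ensures \<open>4 / \<epsilon> \<le> K'\<close>, and it equals \<open>card V\<close>, so that
        no part is empty, as soon as \<open>card V\<close> is at least
        \<open>4 / \<epsilon>\<close>.\<close>
      define K' where "K' = max (card V) (nat \<lceil>4 / \<epsilon>\<rceil>)"
      have "nat \<lceil>4 / \<epsilon>\<rceil> \<le> K" using K4 K_ge by (simp add: nat_le_iff ceiling_le_iff)
      then have K'K: "K' \<le> K" using False by (simp add: K'_def)
      have K'4: "4 / \<epsilon> \<le> real K'"
        using real_nat_ceiling_ge[of "4 / \<epsilon>"] by (simp add: K'_def)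
      obtain P where P: "equitable_partition V K' P" "card V = K' \<longrightarrow> (\<forall>i\<in>{1..K'}. P i \<noteq> {})"
        "{(i, j). 1 \<le> i \<and> i < j \<and> j \<le> K' \<and> \<not> (\<exists>k\<in>{1..m}. complete_pair (E k) (P i) (P j))} = {}"
        using ex_partition_into_singletons[OF V _ cover m, of K'] by (auto simp: K'_def)
      have "card V = K'" if "4 / \<epsilon> \<le> real (card V)"
      proof -
        have "nat \<lceil>4 / \<epsilon>\<rceil> \<le> card V" using that by (simp add: nat_le_iff ceiling_le_iff)
        then show ?thesis by (simp add: K'_def)
      qed
      moreover have "real K' \<le> (real m / \<epsilon>) powr (real q + 1)"
        using K_powr K'K unfolding z_def by linarith
      moreover have "real (card {(i, j). 1 \<le> i \<and> i < j \<and> j \<le> K' \<and>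
          \<not> (\<exists>k\<in>{1..m}. complete_pair (E k) (P i) (P j))}) \<le> \<epsilon> * real (K' choose 2)"
        unfolding P(3) using \<epsilon>(1) by simp
      ultimately show ?thesis using P(1,2) K'4
        by (intro exI[of _ K'] exI[of _ P] conjI) (assumption | blast)+
    qed
  qed
qed

end
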